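(* Let $(S,\mathcal S,\pi)$ be a $\sigma$-finite measure space and let $L^0_{\rm st}=L^0\big(S,\mathcal S,\pi;\mathcal P(\mathbb R)\big)$, ordered by $\leq_{L^0_{\rm st}}$. a) The lattice $L^0_{\rm st}$ is Dedekind super complete. b) Let $M\subset L^0_{\rm st}$ be nonempty. If $M$ is bounded above and directed upwards, then there exists a sequence $(\mu^n)_{n\in\mathbb N}\subset M$ with $\mu^n\leq_{L^0_{\rm st}}\mu^{n+1}$ for all $n\in\mathbb N$ and $\mu^n\to\sup M$ weakly $\pi$-a.e. as $n\to\infty$. If $M$ is bounded below and directed downwards, then there exists a sequence $(\mu^n)_{n\in\mathbb N}\subset M$ with $\mu^n\geq_{L^0_{\rm st}}\mu^{n+1}$ for all $n\in\mathbb N$ and $\mu^n\to\inf M$ weakly $\pi$-a.e. as $n\to\infty$.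
   Context: $\mathcal P(\mathbb R)$ is the set of all Borel probability measures on $\mathbb R$, endowed with the weak topology and its Borel $\sigma$-algebra $\mathcal B(\mathcal P(\mathbb R))$. For $\mu\in\mathcal P(\mathbb R)$ let $\mu_0(s):=\mu((s,\infty))$, $s\in\mathbb R$. First order stochastic dominance is the partial order $\mu\leq_{\rm st}\nu$ iff $\mu_0(s)\leq\nu_0(s)$ for all $s\in\mathbb R$; it makes $\mathcal P(\mathbb R)$ a lattice, with join and meet given by the pointwise maximum and minimum of the functions $\mu_0,\nu_0$. $L^0(S,\mathcal S,\pi;\mathcal P(\mathbb R))$ is the set of all equivalence classes (with respect to $\pi$-a.e. equality) of $\mathcal S$-$\mathcal B(\mathcal P(\mathbb R))$-measurable functions $\mu=(\mu_t)_{t\in S}\colon S\to\mathcal P(\mathbb R)$. The order is $\mu\leq_{L^0_{\rm st}}\nu$ iff $\mu_t\leq_{\rm st}\nu_t$ for $\pi$-a.a. $t\in S$. Boundedness, suprema and infima refer to this order. "$\mu^n\to\mu$ weakly $\pi$-a.e." means that $\mu^n_t\to\mu_t$ weakly for $\pi$-a.a. $t\in S$. A lattice $L$ is Dedekind super complete if every nonempty subset of $L$ that is bounded above (respectively below) has a least upper bound (respectively greatest lower bound) and has a countable subset with the same least upper bound (respectively greatest lower bound). A subset $M$ of a lattice is directed upwards (respectively downwards) if for all $x,y\in M$ there is $z\in M$ with $x\vee y\leq z$ (respectively $x\wedge y\geq z$). *)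

theory Defs
  imports "HOL-Probability.Probability" "HOL-Algebra.Lattice"
begin

subsection \<open>Borel probability measures on the real line\<close>

definition borel_probs :: "real measure set" where
  "borel_probs = {\<mu>. real_distribution \<mu>}"

text \<open>The weak topology: the coarsest one that makes \<open>\<mu> \<mapsto> \<integral>f d\<mu>\<close> continuous for every bounded
  continuous \<open>f\<close>.\<close>

definition weak_topology :: "real measure topology" where
  "weak_topology = topology_generated_by
     {{\<mu> \<in> borel_probs. (\<integral>x. f x \<partial>\<mu>) \<in> U} | (f :: real \<Rightarrow> real) U.
        continuous_on UNIV f \<and> bounded (range f) \<and> open U}"

definition borel_probs_algebra :: "real measure measure" where
  "borel_probs_algebra = sigma borel_probs {U. openin weak_topology U}"

definition st_le :: "real measure \<Rightarrow> real measure \<Rightarrow> bool" (infix \<open>\<le>\<^sub>s\<^sub>t\<close> 50) where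
  "\<mu> \<le>\<^sub>s\<^sub>t \<nu> \<longleftrightarrow> (\<forall>s. measure \<mu> {s<..} \<le> measure \<nu> {s<..})"

lemma topspace_weak_topology [simp]: "topspace weak_topology = borel_probs"
proof -
  let ?B = "{{\<mu> \<in> borel_probs. (\<integral>x. f x \<partial>\<mu>) \<in> U} | (f :: real \<Rightarrow> real) U.
        continuous_on UNIV f \<and> bounded (range f) \<and> open U}"
  have "borel_probs \<in> ?B"
    by (rule CollectI, rule exI[of _ "\<lambda>_. 0"], rule exI[of _ UNIV])
       (auto simp: continuous_on_const)
  then have "\<Union>?B = borel_probs"
    by blast
  then show ?thesis
    by (simp add: weak_topology_def)
qed

text \<open>Convergence in this topology agrees with the library's notion of weak convergence, which is
  defined through distribution functions.\<close>

lemma limitin_weak_topology_iff: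
  assumes M: "\<And>n. \<mu> n \<in> borel_probs" and N: "\<nu> \<in> borel_probs"
  shows "limitin weak_topology \<mu> \<nu> sequentially \<longleftrightarrow> weak_conv_m \<mu> \<nu>"
proof
  assume lim: "limitin weak_topology \<mu> \<nu> sequentially"
  show "weak_conv_m \<mu> \<nu>"
  proof (rule integral_bdd_continuous_conv_imp_weak_conv)
    fix f :: "real \<Rightarrow> real"
    assume f: "\<And>x. isCont f x" "\<And>x. \<bar>f x\<bar> \<le> 1"
    then have "continuous_on UNIV f" "bounded (range f)"
      by (auto simp: continuous_on_eq_continuous_at bounded_iff)
    then have op: "openin weak_topology {\<mu> \<in> borel_probs. (\<integral>x. f x \<partial>\<mu>) \<in> U}" if "open U" for U
      unfolding weak_topology_def using that by (intro topology_generated_by_Basis) blast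
    show "(\<lambda>n. \<integral>x. f x \<partial>\<mu> n) \<longlonglongrightarrow> (\<integral>x. f x \<partial>\<nu>)"
    proof (rule topological_tendstoI)
      fix U :: "real set" assume U: "open U" "(\<integral>x. f x \<partial>\<nu>) \<in> U"
      with lim op[OF U(1)] N
      have "\<forall>\<^sub>F n in sequentially. \<mu> n \<in> {\<mu> \<in> borel_probs. (\<integral>x. f x \<partial>\<mu>) \<in> U}"
        unfolding limitin_def by blast
      then show "\<forall>\<^sub>F n in sequentially. (\<integral>x. f x \<partial>\<mu> n) \<in> U"
        by (rule eventually_mono) simp
    qed
  qed (use M N in \<open>auto simp: borel_probs_def\<close>)
next
  assume conv: "weak_conv_m \<mu> \<nu>"
  let ?B = "{{\<mu> \<in> borel_probs. (\<integral>x. f x \<partial>\<mu>) \<in> U} | (f :: real \<Rightarrow> real) U.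
        continuous_on UNIV f \<and> bounded (range f) \<and> open U}"
  have "\<nu> \<in> V \<longrightarrow> (\<forall>\<^sub>F n in sequentially. \<mu> n \<in> V)" if "generate_topology_on ?B V" for V
    using that
  proof induction
    case (Int a b)
    then show ?case
      by (auto intro: eventually_conj)
  next
    case (UN K)
    show ?case
    proof
      assume "\<nu> \<in> \<Union>K"
      then obtain k where "k \<in> K" "\<forall>\<^sub>F n in sequentially. \<mu> n \<in> k"
        using UN by blast
      then show "\<forall>\<^sub>F n in sequentially. \<mu> n \<in> \<Union>K"
        by - (erule eventually_mono, blast)
    qed
  next
    case (Basis V)
    then obtain f U where V: "V = {\<mu> \<in> borel_probs. (\<integral>x. f x \<partial>\<mu>) \<in> U}"
      and f: "continuous_on UNIV f" "bounded (range f)" and U: "open (U :: real set)"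
      by blast
    obtain B where "\<And>x. norm (f x) \<le> B"
      using f(2) by (auto simp: bounded_iff)
    then have "(\<lambda>n. \<integral>x. f x \<partial>\<mu> n) \<longlonglongrightarrow> (\<integral>x. f x \<partial>\<nu>)"
      using M N f(1) conv
      by (intro weak_conv_imp_integral_bdd_continuous_conv)
         (auto simp: borel_probs_def continuous_on_eq_continuous_at)
    then show ?case
      using U M unfolding V by (auto dest: topological_tendstoD)
  qed simp
  then show "limitin weak_topology \<mu> \<nu> sequentially"
    unfolding limitin_def topspace_weak_topology using N
    by (simp add: weak_topology_def openin_topology_generated_by_iff)
qed


subsection \<open>The space of random probability measures modulo a.e. equality\<close>

definition L0_rel :: "'a measure \<Rightarrow> (('a \<Rightarrow> real measure) \<times> ('a \<Rightarrow> real measure)) set" where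
  "L0_rel \<pi> = {(f, g). f \<in> \<pi> \<rightarrow>\<^sub>M borel_probs_algebra \<and> g \<in> \<pi> \<rightarrow>\<^sub>M borel_probs_algebra \<and>
                      (AE t in \<pi>. f t = g t)}"

definition L0_space :: "'a measure \<Rightarrow> ('a \<Rightarrow> real measure) set set" where
  "L0_space \<pi> = (\<pi> \<rightarrow>\<^sub>M borel_probs_algebra) // L0_rel \<pi>"

definition L0_le :: "'a measure \<Rightarrow> ('a \<Rightarrow> real measure) set \<Rightarrow> ('a \<Rightarrow> real measure) set \<Rightarrow> bool" where
  "L0_le \<pi> \<mu> \<nu> \<longleftrightarrow> (\<exists>f\<in>\<mu>. \<exists>g\<in>\<nu>. AE t in \<pi>. f t \<le>\<^sub>s\<^sub>t g t)"

definition L0_st :: "'a measure \<Rightarrow> ('a \<Rightarrow> real measure) set gorder" where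
  "L0_st \<pi> = \<lparr>carrier = L0_space \<pi>, eq = (=), le = L0_le \<pi>\<rparr>"

definition weakly_ae ::
  "'a measure \<Rightarrow> (nat \<Rightarrow> ('a \<Rightarrow> real measure) set) \<Rightarrow> ('a \<Rightarrow> real measure) set \<Rightarrow> bool" where
  "weakly_ae \<pi> \<mu> \<nu> \<longleftrightarrow> (\<exists>f g. (\<forall>n. f n \<in> \<mu> n) \<and> g \<in> \<nu> \<and>
     (AE t in \<pi>. limitin weak_topology (\<lambda>n. f n t) (g t) sequentially))"

text \<open>The order and the convergence do not depend on the representatives.\<close>

lemma equiv_L0_rel: "equiv (\<pi> \<rightarrow>\<^sub>M borel_probs_algebra) (L0_rel \<pi>)"
proof (rule equivI)
  show "refl_on (\<pi> \<rightarrow>\<^sub>M borel_probs_algebra) (L0_rel \<pi>)"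
    by (auto simp: refl_on_def L0_rel_def)
  show "sym (L0_rel \<pi>)"
    by (auto simp: sym_def L0_rel_def eq_commute)
  show "trans (L0_rel \<pi>)"
  proof (rule transI)
    fix f g h assume "(f, g) \<in> L0_rel \<pi>" "(g, h) \<in> L0_rel \<pi>"
    then have fg: "AE t in \<pi>. f t = g t" and gh: "AE t in \<pi>. g t = h t"
      and meas: "f \<in> \<pi> \<rightarrow>\<^sub>M borel_probs_algebra" "h \<in> \<pi> \<rightarrow>\<^sub>M borel_probs_algebra"
      by (auto simp: L0_rel_def)
    from fg gh have "AE t in \<pi>. f t = h t"
      by eventually_elim simp
    with meas show "(f, h) \<in> L0_rel \<pi>"
      by (simp add: L0_rel_def)
  qed
qed (auto simp: L0_rel_def)

lemma L0_space_AE_eq: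
  assumes "\<mu> \<in> L0_space \<pi>" "f \<in> \<mu>" "f' \<in> \<mu>"
  shows "AE t in \<pi>. f t = f' t"
proof -
  have "(f, f') \<in> L0_rel \<pi>"
    using quotient_eq_iff[OF equiv_L0_rel, of \<mu> \<pi> \<mu> f f'] assms by (simp add: L0_space_def)
  then show ?thesis
    by (simp add: L0_rel_def)
qed

lemma L0_le_iff:
  assumes "\<mu> \<in> L0_space \<pi>" "\<nu> \<in> L0_space \<pi>" "f \<in> \<mu>" "g \<in> \<nu>"
  shows "L0_le \<pi> \<mu> \<nu> \<longleftrightarrow> (AE t in \<pi>. f t \<le>\<^sub>s\<^sub>t g t)"
proof
  assume "L0_le \<pi> \<mu> \<nu>"
  then obtain f' g' where fg: "f' \<in> \<mu>" "g' \<in> \<nu>" and le: "AE t in \<pi>. f' t \<le>\<^sub>s\<^sub>t g' t"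
    unfolding L0_le_def by blast
  from le L0_space_AE_eq[OF assms(1) assms(3) fg(1)] L0_space_AE_eq[OF assms(2) assms(4) fg(2)]
  show "AE t in \<pi>. f t \<le>\<^sub>s\<^sub>t g t"
    by eventually_elim simp
qed (use assms in \<open>auto simp: L0_le_def\<close>)

lemma weakly_ae_iff:
  assumes "\<And>n. \<mu> n \<in> L0_space \<pi>" "\<nu> \<in> L0_space \<pi>" "\<And>n. f n \<in> \<mu> n" "g \<in> \<nu>"
  shows "weakly_ae \<pi> \<mu> \<nu> \<longleftrightarrow>
    (AE t in \<pi>. limitin weak_topology (\<lambda>n. f n t) (g t) sequentially)"
proof
  assume "weakly_ae \<pi> \<mu> \<nu>"
  then obtain f' g' where fg: "\<And>n. f' n \<in> \<mu> n" "g' \<in> \<nu>"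
    and lim: "AE t in \<pi>. limitin weak_topology (\<lambda>n. f' n t) (g' t) sequentially"
    unfolding weakly_ae_def by blast
  note lim
  moreover have "AE t in \<pi>. \<forall>n. f n t = f' n t"
    unfolding AE_all_countable using L0_space_AE_eq[OF assms(1) assms(3) fg(1)] by blast
  moreover note L0_space_AE_eq[OF assms(2) assms(4) fg(2)]
  ultimately show "AE t in \<pi>. limitin weak_topology (\<lambda>n. f n t) (g t) sequentially"
    by eventually_elim simp
qed (use assms in \<open>auto simp: weakly_ae_def\<close>)


subsection \<open>Order-theoretic notions\<close>

definition bounded_above :: "('a, 'b) gorder_scheme \<Rightarrow> 'a set \<Rightarrow> bool" where
  "bounded_above L A \<longleftrightarrow> Upper L A \<noteq> {}"

definition bounded_below :: "('a, 'b) gorder_scheme \<Rightarrow> 'a set \<Rightarrow> bool" where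
  "bounded_below L A \<longleftrightarrow> Lower L A \<noteq> {}"

definition Dedekind_super_complete :: "('a, 'b) gorder_scheme \<Rightarrow> bool" where
  "Dedekind_super_complete L \<longleftrightarrow>
     (\<forall>A. A \<subseteq> carrier L \<and> A \<noteq> {} \<and> bounded_above L A \<longrightarrow>
        (\<exists>s. least L s (Upper L A) \<and>
           (\<exists>C. C \<subseteq> A \<and> countable C \<and> least L s (Upper L C)))) \<and>
     (\<forall>A. A \<subseteq> carrier L \<and> A \<noteq> {} \<and> bounded_below L A \<longrightarrow>
        (\<exists>i. greatest L i (Lower L A) \<and>
           (\<exists>C. C \<subseteq> A \<and> countable C \<and> greatest L i (Lower L C))))"

definition directed_upwards :: "('a, 'b) gorder_scheme \<Rightarrow> 'a set \<Rightarrow> bool" where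
  "directed_upwards L M \<longleftrightarrow> (\<forall>x\<in>M. \<forall>y\<in>M. \<exists>z\<in>M. x \<squnion>\<^bsub>L\<^esub> y \<sqsubseteq>\<^bsub>L\<^esub> z)"

definition directed_downwards :: "('a, 'b) gorder_scheme \<Rightarrow> 'a set \<Rightarrow> bool" where
  "directed_downwards L M \<longleftrightarrow> (\<forall>x\<in>M. \<forall>y\<in>M. \<exists>z\<in>M. z \<sqsubseteq>\<^bsub>L\<^esub> x \<sqinter>\<^bsub>L\<^esub> y)"

end

theory Submission
  imports Defs "HOL-Analysis.Function_Metric"
begin

text \<open>
  A measure \<open>\<mu>\<close> is determined by its tails \<open>\<mu>((q, \<infinity>))\<close> at rational \<open>q\<close>, and these countably many
  numbers carry everything: the stochastic order, weak convergence of monotone sequences, and the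
  Borel structure of the weak topology. For every rational \<open>q\<close>, an exhaustion argument yields a
  countable subfamily whose pointwise supremum of tails at \<open>q\<close> dominates the whole family almost
  everywhere; the union over \<open>q\<close> is a countable subfamily with the same supremum, and the
  right-continuous regularisation of its pointwise supremum (or infimum) is again a tail function,
  because the bound of the family controls its limits at \<open>\<plusminus>\<infinity>\<close>.
\<close>

subsection \<open>Tail functions\<close>

text \<open>A pointwise supremum over an uncountable family depends on the representatives and need
  not be measurable, so every comparison is reduced to countably many real functions, whose
  exceptional null sets can be united. Sigma-finiteness supplies a strictly positive integrable
  weight: weighted integrals of bounded functions are finite, and ordered functions with equal
  weighted integrals agree almost everywhere.

  Suprema and infima behave differently at the level of tails. Superlevel sets of a tail are open,
  so a supremum of tails stays right-continuous; an infimum need not. The tails of the Dirac masses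
  at 1/n have infimum 1 at the point 0, whereas their greatest lower bound, the Dirac mass at 0, has
  tail 0 there. Regularising in both cases removes the asymmetry and costs nothing: the
  regularisation is monotone and fixes genuine tails, so comparisons with measures survive, and it
  alters a limit of tails only at jumps, which weak convergence ignores.\<close>

abbreviation tail :: "real measure \<Rightarrow> real \<Rightarrow> real" where
  "tail \<mu> s \<equiv> measure \<mu> {s<..}"

abbreviation rtail :: "real measure \<Rightarrow> rat \<Rightarrow> real" where
  "rtail \<mu> q \<equiv> tail \<mu> (of_rat q)"

lemma tail_eq_cdf:
  assumes "\<mu> \<in> borel_probs"
  shows "tail \<mu> s = 1 - cdf \<mu> s"
proof -
  interpret real_distribution \<mu> using assms by (simp add: borel_probs_def)
  have "{s<..} = space \<mu> - {..s}" by auto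
  then show ?thesis by (simp add: cdf_def prob_compl del: space_eq_univ)
qed

lemma tail_antimono:
  assumes "\<mu> \<in> borel_probs" "s \<le> s'"
  shows "tail \<mu> s' \<le> tail \<mu> s"
proof -
  interpret real_distribution \<mu> using assms by (simp add: borel_probs_def)
  show ?thesis using assms by (simp add: tail_eq_cdf cdf_nondecreasing)
qed

lemma tail_bounds:
  assumes "\<mu> \<in> borel_probs"
  shows "0 \<le> tail \<mu> s" "tail \<mu> s \<le> 1"
proof -
  interpret real_distribution \<mu> using assms by (simp add: borel_probs_def)
  show "0 \<le> tail \<mu> s" "tail \<mu> s \<le> 1" by auto
qed

lemma tail_lim:
  assumes "\<mu> \<in> borel_probs"
  shows "(tail \<mu> \<longlongrightarrow> 1) at_bot" "(tail \<mu> \<longlongrightarrow> 0) at_top"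
proof -
  interpret real_distribution \<mu> using assms by (simp add: borel_probs_def)
  have "((\<lambda>s. 1 - cdf \<mu> s) \<longlongrightarrow> 1 - 0) at_bot" "((\<lambda>s. 1 - cdf \<mu> s) \<longlongrightarrow> 1 - 1) at_top"
    by (intro tendsto_intros cdf_lim_at_bot cdf_lim_at_top_prob)+
  then show "(tail \<mu> \<longlongrightarrow> 1) at_bot" "(tail \<mu> \<longlongrightarrow> 0) at_top"
    by (simp_all add: tail_eq_cdf[OF assms])
qed

text \<open>A pointwise infimum of tail functions need not be right-continuous; this is the
  right-continuous regularisation of a function known at the rationals.\<close>

definition rat_closure :: "(rat \<Rightarrow> real) \<Rightarrow> real \<Rightarrow> real" where
  "rat_closure G s = (SUP q\<in>{q. s < of_rat q}. G q)"

lemma rats_above_nonempty: "{q::rat. (s::real) < of_rat q} \<noteq> {}"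
  using of_rat_dense[of s "s + 1"] by auto

lemma bdd_above_image_of_range: "bdd_above (range f) \<Longrightarrow> bdd_above (f ` A)"
  by (rule bdd_above_mono) (auto intro: image_mono)

lemma less_rat_closure_iff:
  assumes "bdd_above (range G)"
  shows "c < rat_closure G s \<longleftrightarrow> (\<exists>q. s < of_rat q \<and> c < G q)"
  unfolding rat_closure_def
  by (subst less_cSUP_iff[OF rats_above_nonempty bdd_above_image_of_range[OF assms]]) auto

lemma rat_closure_upper:
  assumes "bdd_above (range G)" "s < of_rat q"
  shows "G q \<le> rat_closure G s"
  unfolding rat_closure_def
  by (rule cSUP_upper[OF _ bdd_above_image_of_range[OF assms(1)]]) (simp add: assms(2))

lemma rat_closure_least:
  assumes "\<And>q. s < of_rat q \<Longrightarrow> G q \<le> c"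
  shows "rat_closure G s \<le> c"
  unfolding rat_closure_def by (intro cSUP_least rats_above_nonempty) (use assms in auto)

lemma rat_closure_mono:
  assumes "bdd_above (range G')" "\<And>q. G q \<le> G' q"
  shows "rat_closure G s \<le> rat_closure G' s"
  by (rule rat_closure_least) (rule order_trans[OF assms(2) rat_closure_upper[OF assms(1)]])

lemma bdd_above_rtail: "\<mu> \<in> borel_probs \<Longrightarrow> bdd_above (range (rtail \<mu>))"
  by (rule bdd_aboveI[where M=1]) (auto simp: tail_bounds)

text \<open>Antitonicity gives one inequality and right-continuity of the cdf the other. Together
  with monotonicity of \<open>rat_closure\<close>, this is why rational tails determine both the
  measure and the stochastic order.\<close>

lemma rat_closure_rtail:
  assumes \<mu>: "\<mu> \<in> borel_probs"
  shows "rat_closure (rtail \<mu>) s = tail \<mu> s"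
proof (rule antisym)
  show "rat_closure (rtail \<mu>) s \<le> tail \<mu> s"
    by (rule rat_closure_least) (simp add: tail_antimono[OF \<mu>])
  show "tail \<mu> s \<le> rat_closure (rtail \<mu>) s"
  proof (rule dense_le)
    fix c assume "c < tail \<mu> s"
    interpret real_distribution \<mu> using \<mu> by (simp add: borel_probs_def)
    have "((\<lambda>x. 1 - cdf \<mu> x) \<longlongrightarrow> 1 - cdf \<mu> s) (at_right s)"
      using cdf_is_right_cont[of s] by (intro tendsto_intros) (simp add: continuous_within)
    then have "(tail \<mu> \<longlongrightarrow> tail \<mu> s) (at_right s)"
      by (simp add: tail_eq_cdf[OF \<mu>])
    from order_tendstoD(1)[OF this \<open>c < tail \<mu> s\<close>]
    obtain b where b: "s < b" "\<And>y. s < y \<Longrightarrow> y < b \<Longrightarrow> c < tail \<mu> y"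
      unfolding eventually_at_right_field by blast
    obtain q where "s < of_rat q" "of_rat q < b"
      using of_rat_dense[OF b(1)] by auto
    with b(2) show "c \<le> rat_closure (rtail \<mu>) s"
      using less_rat_closure_iff[OF bdd_above_rtail[OF \<mu>]] less_imp_le by blast
  qed
qed

lemma st_le_iff_rtail:
  assumes "\<mu> \<in> borel_probs" "\<nu> \<in> borel_probs"
  shows "\<mu> \<le>\<^sub>s\<^sub>t \<nu> \<longleftrightarrow> (\<forall>q. rtail \<mu> q \<le> rtail \<nu> q)"
proof
  assume *: "\<forall>q. rtail \<mu> q \<le> rtail \<nu> q"
  show "\<mu> \<le>\<^sub>s\<^sub>t \<nu>"
    unfolding st_le_def
    using rat_closure_mono[OF bdd_above_rtail[OF assms(2)], of "rtail \<mu>"] *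
    by (simp add: rat_closure_rtail assms)
qed (simp add: st_le_def)

lemma borel_probs_eqI:
  assumes "\<mu> \<in> borel_probs" "\<nu> \<in> borel_probs" "\<And>q. rtail \<mu> q = rtail \<nu> q"
  shows "\<mu> = \<nu>"
proof (rule cdf_unique)
  show "cdf \<mu> = cdf \<nu>"
  proof
    fix s
    have "rtail \<mu> = rtail \<nu>" using assms(3) by blast
    then have "tail \<mu> s = tail \<nu> s"
      using rat_closure_rtail assms(1,2) by metis
    then show "cdf \<mu> s = cdf \<nu> s" using assms(1,2) by (simp add: tail_eq_cdf)
  qed
qed (use assms in \<open>simp_all add: borel_probs_def\<close>)

text \<open>The measures \<alpha> and \<beta> squeeze the regularisation and so force its limits 1
  and 0; \<open>interval_measure\<close> then realises it. The bounds use \<open>min\<close> and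
  \<open>max\<close> instead of a fixed lower and upper measure, since the two exchange roles when
  the order is reversed.\<close>

lemma ex_prob_of_rat_closure:
  assumes anti: "\<And>p q. p \<le> q \<Longrightarrow> G q \<le> G p"
    and ab: "\<alpha> \<in> borel_probs" "\<beta> \<in> borel_probs"
    and lower: "\<And>q. min (rtail \<alpha> q) (rtail \<beta> q) \<le> G q"
    and upper: "\<And>q. G q \<le> max (rtail \<alpha> q) (rtail \<beta> q)"
  shows "\<exists>\<mu>\<in>borel_probs. \<forall>s. tail \<mu> s = rat_closure G s"
proof -
  have G1: "G q \<le> 1" for q
    using upper[of q] tail_bounds(2)[OF ab(1)] tail_bounds(2)[OF ab(2)]
    by (meson max.bounded_iff order_trans)
  have bdd: "bdd_above (range G)"
    by (rule bdd_aboveI[where M=1]) (auto simp: G1)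
  let ?H = "rat_closure G"
  have H_anti: "?H y \<le> ?H x" if "x \<le> y" for x y
    using that by (intro rat_closure_least rat_closure_upper[OF bdd]) auto
  have H_le: "?H s \<le> max (tail \<alpha> s) (tail \<beta> s)" for s
  proof (rule rat_closure_least)
    fix q assume "s < of_rat q"
    then have "rtail \<alpha> q \<le> tail \<alpha> s" "rtail \<beta> q \<le> tail \<beta> s"
      by (auto intro: tail_antimono ab)
    then show "G q \<le> max (tail \<alpha> s) (tail \<beta> s)"
      using upper[of q] by linarith
  qed
  \<comment> \<open>\<open>?H s\<close> sees only rationals strictly above \<open>s\<close>. The
    shift by 1 leaves room for one of them, at which the lower bound on \<open>G\<close> can be
    used, and it does not affect the limit at minus infinity.\<close>
  have H_ge: "min (tail \<alpha> (s + 1)) (tail \<beta> (s + 1)) \<le> ?H s" for s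
  proof -
    obtain q where q: "s < of_rat q" "of_rat q < s + 1"
      using of_rat_dense[of s "s + 1"] by auto
    then have "tail \<alpha> (s + 1) \<le> rtail \<alpha> q" "tail \<beta> (s + 1) \<le> rtail \<beta> q"
      by (auto intro: tail_antimono ab)
    then show ?thesis
      using lower[of q] rat_closure_upper[OF bdd q(1)] by linarith
  qed
  have H1: "?H s \<le> 1" for s
    by (rule rat_closure_least) (rule G1)
  let ?F = "\<lambda>s. 1 - ?H s"
  have lim_bot: "(?H \<longlongrightarrow> 1) at_bot"
  proof (rule tendsto_sandwich[OF _ _ _ tendsto_const])
    have "filterlim (\<lambda>s. s + 1 :: real) at_bot at_bot"
      unfolding filterlim_at_bot
    proof
      fix Z :: real
      show "\<forall>\<^sub>F s in at_bot. s + 1 \<le> Z"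
        using eventually_le_at_bot[of "Z - 1"] by eventually_elim simp
    qed
    from filterlim_compose[OF tail_lim(1)[OF ab(1)] this]
      filterlim_compose[OF tail_lim(1)[OF ab(2)] this]
    have "((\<lambda>s. min (tail \<alpha> (s + 1)) (tail \<beta> (s + 1))) \<longlongrightarrow> min 1 1) at_bot"
      by (rule tendsto_min)
    then show "((\<lambda>s. min (tail \<alpha> (s + 1)) (tail \<beta> (s + 1))) \<longlongrightarrow> 1) at_bot" by simp
  qed (auto intro: always_eventually H_ge H1)
  have lim_top: "(?H \<longlongrightarrow> 0) at_top"
  proof (rule tendsto_sandwich[OF _ _ tendsto_const])
    have "((\<lambda>s. max (tail \<alpha> s) (tail \<beta> s)) \<longlongrightarrow> max 0 0) at_top"
      by (intro tendsto_max tail_lim ab)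
    then show "((\<lambda>s. max (tail \<alpha> s) (tail \<beta> s)) \<longlongrightarrow> 0) at_top" by simp
    show "\<forall>\<^sub>F s in at_top. 0 \<le> ?H s"
      by (intro always_eventually allI order_trans[OF _ H_ge]) (simp add: tail_bounds ab)
  qed (auto intro: always_eventually H_le)
  \<comment> \<open>A rational \<open>q\<close> that witnesses \<open>c < ?H s\<close> also
    witnesses \<open>c < ?H y\<close> for every \<open>y\<close> below \<open>q\<close>; the other
    half of the limit needs only that \<open>?H\<close> is antitone.\<close>
  have rc: "continuous (at_right s) ?F" for s
  proof -
    have "(?H \<longlongrightarrow> ?H s) (at_right s)"
    proof (rule order_tendstoI)
      fix c assume "c < ?H s"
      then obtain q where q: "s < of_rat q" "c < G q"
        using less_rat_closure_iff[OF bdd] by blast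
      have "\<forall>\<^sub>F y in at_right s. y < of_rat q"
        using q(1) by (auto simp: eventually_at_right_field)
      then show "\<forall>\<^sub>F y in at_right s. c < ?H y"
        by (rule eventually_mono) (use less_rat_closure_iff[OF bdd] q(2) in blast)
    next
      fix c assume "?H s < c"
      then show "\<forall>\<^sub>F y in at_right s. ?H y < c"
        by (intro eventually_at_rightI[of s "s + 1"])
           (auto intro: le_less_trans[OF H_anti] less_imp_le)
    qed
    then show ?thesis by (auto simp: continuous_within intro!: tendsto_intros)
  qed
  have F_mono: "?F x \<le> ?F y" if "x \<le> y" for x y
    using H_anti[OF that] by simp
  have F_bot: "(?F \<longlongrightarrow> 0) at_bot" using tendsto_diff[OF tendsto_const lim_bot, of 1] by simp
  have F_top: "(?F \<longlongrightarrow> 1) at_top" using tendsto_diff[OF tendsto_const lim_top, of 1] by simp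
  have "interval_measure ?F \<in> borel_probs"
    using real_distribution_interval_measure[OF F_mono rc F_bot F_top] by (simp add: borel_probs_def)
  moreover have "cdf (interval_measure ?F) = ?F"
    by (rule cdf_interval_measure[OF F_mono rc F_bot])
  ultimately show ?thesis
    by (auto intro!: bexI[of _ "interval_measure ?F"] simp: tail_eq_cdf)
qed

text \<open>The limit \<open>G\<close> of the rational tails need not be a tail function; it may
  differ from its regularisation, but only where \<open>tail h\<close> jumps, and weak convergence
  does not test those points.\<close>

lemma limitin_weak_topologyI:
  assumes m: "\<And>n. m n \<in> borel_probs" and h: "h \<in> borel_probs"
    and G: "\<And>q. (\<lambda>n. rtail (m n) q) \<longlonglongrightarrow> G q"
    and H: "\<And>s. tail h s = rat_closure G s"
  shows "limitin weak_topology m h sequentially"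
  unfolding limitin_weak_topology_iff[OF m h] weak_conv_m_def weak_conv_def
proof (intro allI impI)
  fix s assume "isCont (cdf h) s"
  then have "isCont (\<lambda>x. 1 - cdf h x) s" by (intro continuous_intros)
  then have cont: "isCont (tail h) s" by (simp add: tail_eq_cdf[OF h])
  have "G q \<le> 1" for q
    using LIMSEQ_le_const2[OF G] tail_bounds(2)[OF m] by blast
  then have bdd: "bdd_above (range G)"
    by (intro bdd_aboveI[where M=1]) auto
  have "(\<lambda>n. tail (m n) s) \<longlonglongrightarrow> tail h s"
  proof (rule order_tendstoI)
    fix c assume "c < tail h s"
    then obtain q where q: "s < of_rat q" "c < G q"
      unfolding H less_rat_closure_iff[OF bdd] by blast
    from order_tendstoD(1)[OF G q(2)] show "\<forall>\<^sub>F n in sequentially. c < tail (m n) s"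
      by (rule eventually_mono) (use q(1) tail_antimono[OF m] in \<open>meson less_imp_le less_le_trans\<close>)
  next
    \<comment> \<open>Continuity at \<open>s\<close> enters only here. It yields
      \<open>y < s\<close> with \<open>tail h y < c\<close>; a rational \<open>q\<close> between
      \<open>y\<close> and \<open>s\<close> satisfies \<open>G q \<le> tail h y\<close>, and the
      tails at \<open>s\<close> lie below those at \<open>q\<close>.\<close>
    fix c assume c: "tail h s < c"
    have "(tail h \<longlongrightarrow> tail h s) (at_left s)"
      using cont by (simp add: isCont_def filterlim_at_split)
    from order_tendstoD(2)[OF this c]
    obtain b where b: "b < s" "\<And>y. b < y \<Longrightarrow> y < s \<Longrightarrow> tail h y < c"
      unfolding eventually_at_left_field by blast
    obtain y where y: "b < y" "y < s" using dense[OF b(1)] by blast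
    obtain q where q: "y < of_rat q" "of_rat q < s"
      using of_rat_dense[OF y(2)] by auto
    have "G q < c"
      using rat_closure_upper[OF bdd q(1)] b(2)[OF y] by (simp add: H)
    from order_tendstoD(2)[OF G this] show "\<forall>\<^sub>F n in sequentially. tail (m n) s < c"
      by (rule eventually_mono) (use q(2) tail_antimono[OF m] in \<open>meson less_imp_le le_less_trans\<close>)
  qed
  then have "(\<lambda>n. 1 - tail (m n) s) \<longlonglongrightarrow> 1 - tail h s" by (intro tendsto_intros)
  then show "(\<lambda>n. cdf (m n) s) \<longlonglongrightarrow> cdf h s"
    by (simp add: tail_eq_cdf m h)
qed

subsection \<open>Measurability\<close>

text \<open>On \<open>\<P>(\<real>)\<close> the metrizable topology of pointwise convergence of rational tails is finer
  than the weak topology, so the separability of the latter is not needed.\<close>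

lemma openin_weak_topology_rtail:
  assumes U: "openin weak_topology U"
  shows "\<exists>V. open (V :: (rat \<Rightarrow> real) set) \<and> U = {\<mu> \<in> borel_probs. rtail \<mu> \<in> V}"
proof -
  let ?pre = "\<lambda>W. {\<mu> \<in> borel_probs. rtail \<mu> \<in> W}"
  let ?V = "\<Union>{W :: (rat \<Rightarrow> real) set. open W \<and> ?pre W \<subseteq> U}"
  have nhds: "\<exists>W. open W \<and> rtail \<mu> \<in> W \<and> ?pre W \<subseteq> U" if "\<mu> \<in> U" for \<mu>
  proof (rule ccontr)
    assume no: "\<not> ?thesis"
    have \<mu>: "\<mu> \<in> borel_probs"
      using that openin_subset[OF U] by auto
    \<comment> \<open>The balls are those of the product metric on functions of a countable index,
      so shrinking radii give a sequence outside \<open>U\<close> whose rational tails converge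
      coordinatewise to those of \<mu>, hence a weakly convergent one.\<close>
    have "\<exists>\<nu>. \<nu> \<in> borel_probs \<and> \<nu> \<notin> U \<and> dist (rtail \<nu>) (rtail \<mu>) < 1 / real (Suc n)" for n
      using no[simplified, rule_format, of "ball (rtail \<mu>) (1 / real (Suc n))"]
      by (auto simp: dist_commute)
    then obtain \<nu> where \<nu>: "\<And>n. \<nu> n \<in> borel_probs" "\<And>n. \<nu> n \<notin> U"
      "\<And>n. dist (rtail (\<nu> n)) (rtail \<mu>) < 1 / real (Suc n)"
      by metis
    have "(\<lambda>n. dist (rtail (\<nu> n)) (rtail \<mu>)) \<longlonglongrightarrow> 0"
      by (rule tendsto_sandwich[OF _ _ tendsto_const LIMSEQ_Suc[OF lim_1_over_n]])
         (use \<nu>(3) in \<open>auto intro!: always_eventually intro: less_imp_le simp del: of_nat_Suc\<close>)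
    then have lim: "(\<lambda>n. rtail (\<nu> n)) \<longlonglongrightarrow> rtail \<mu>"
      by (subst tendsto_dist_iff)
    have "(\<lambda>n. rtail (\<nu> n) q) \<longlonglongrightarrow> rtail \<mu> q" for q
      using continuous_on_tendsto_compose[OF continuous_on_product_coordinates lim] by simp
    from limitin_weak_topologyI[OF \<nu>(1) \<mu> this]
    have "limitin weak_topology \<nu> \<mu> sequentially" by (simp add: rat_closure_rtail[OF \<mu>])
    with U that have "\<forall>\<^sub>F n in sequentially. \<nu> n \<in> U" by (auto simp: limitin_def)
    with \<nu>(2) show False by simp
  qed
  have "U = ?pre ?V"
  proof
    show "U \<subseteq> ?pre ?V"
    proof
      fix \<mu> assume \<mu>: "\<mu> \<in> U"
      from nhds[OF \<mu>] have "rtail \<mu> \<in> ?V" by blast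
      with \<mu> openin_subset[OF U] show "\<mu> \<in> ?pre ?V" by auto
    qed
  qed blast
  then show ?thesis by (intro exI[of _ ?V]) auto
qed

lemma borel_probs_algebra_Pow: "{U. openin weak_topology U} \<subseteq> Pow borel_probs"
  using openin_subset[of weak_topology] by auto

lemma space_borel_probs_algebra [simp]: "space borel_probs_algebra = borel_probs"
  unfolding borel_probs_algebra_def by (rule space_measure_of) (rule borel_probs_algebra_Pow)

lemma measurable_integral_borel_probs_algebra:
  assumes "continuous_on UNIV f" "bounded (range (f :: real \<Rightarrow> real))"
  shows "(\<lambda>\<mu>. \<integral>x. f x \<partial>\<mu>) \<in> borel_measurable borel_probs_algebra"
proof (rule borel_measurableI)
  fix U :: "real set" assume "open U"
  with assms have "openin weak_topology {\<mu> \<in> borel_probs. (\<integral>x. f x \<partial>\<mu>) \<in> U}"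
    unfolding weak_topology_def by (intro topology_generated_by_Basis) blast
  moreover have "(\<lambda>\<mu>. \<integral>x. f x \<partial>\<mu>) -` U \<inter> space borel_probs_algebra = {\<mu> \<in> borel_probs. (\<integral>x. f x \<partial>\<mu>) \<in> U}"
    by auto
  ultimately show "(\<lambda>\<mu>. \<integral>x. f x \<partial>\<mu>) -` U \<inter> space borel_probs_algebra \<in> sets borel_probs_algebra"
    by (simp add: borel_probs_algebra_def sets_measure_of[OF borel_probs_algebra_Pow] del: vimage_Int)
qed

text \<open>The indicator of the open half-line is the pointwise limit of continuous ramps that
  vanish up to and including \<open>s\<close>, so the tail is a limit of weakly continuous
  functionals.\<close>

lemma measurable_tail: "(\<lambda>\<mu>. tail \<mu> s) \<in> borel_measurable borel_probs_algebra"
proof -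
  let ?f = "\<lambda>n x. max 0 (min 1 (real n * (x - s)))"
  have cont: "continuous_on UNIV (?f n)" for n
    by (intro continuous_intros)
  have bdd: "bounded (range (?f n))" for n
    by (rule boundedI[where B=1]) auto
  show ?thesis
  proof (rule borel_measurable_LIMSEQ_real)
    show "(\<lambda>\<mu>. \<integral>x. ?f n x \<partial>\<mu>) \<in> borel_measurable borel_probs_algebra" for n
      by (rule measurable_integral_borel_probs_algebra[OF cont bdd])
    fix \<mu> assume "\<mu> \<in> space borel_probs_algebra"
    then interpret real_distribution \<mu> by (simp add: borel_probs_def)
    have "(\<lambda>n. \<integral>x. ?f n x \<partial>\<mu>) \<longlonglongrightarrow> (\<integral>x. indicator {s<..} x \<partial>\<mu>)"
    proof (rule integral_dominated_convergence[where w="\<lambda>_. 1"])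
      show "AE x in \<mu>. (\<lambda>n. ?f n x) \<longlonglongrightarrow> indicator {s<..} x"
      proof (rule AE_I2)
        fix x
        show "(\<lambda>n. ?f n x) \<longlonglongrightarrow> indicator {s<..} x"
        proof (cases "s < x")
          case True
          obtain N where N: "1 / (x - s) \<le> real N" using real_arch_simple by blast
          have "\<forall>\<^sub>F n in sequentially. ?f n x = 1"
          proof (rule eventually_sequentiallyI[of N])
            fix n assume "N \<le> n"
            then have "1 / (x - s) \<le> real n" using N by linarith
            then have "1 \<le> real n * (x - s)" using True by (simp add: field_simps)
            then show "?f n x = 1" by simp
          qed
          then show ?thesis using True by (simp add: tendsto_eventually)
        next
          case False
          then have "real n * (x - s) \<le> 0" for n by (simp add: mult_nonneg_nonpos)
          then have "?f n x = 0" for n by (smt (verit))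
          then show ?thesis using False by simp
        qed
      qed
      show "?f n \<in> borel_measurable \<mu>" for n
        using borel_measurable_continuous_onI[OF cont[of n]] by simp
    qed auto
    then show "(\<lambda>n. \<integral>x. ?f n x \<partial>\<mu>) \<longlonglongrightarrow> tail \<mu> s" by simp
  qed
qed

text \<open>For the converse, countability of \<open>rat\<close> turns coordinatewise measurability
  into Borel measurability of the map to \<open>rat \<Rightarrow> real\<close>, and every weakly
  open set is the preimage of an open set there.\<close>

lemma measurable_borel_probs_algebra_iff:
  "f \<in> M \<rightarrow>\<^sub>M borel_probs_algebra \<longleftrightarrow>
     (\<forall>t\<in>space M. f t \<in> borel_probs) \<and> (\<forall>q. (\<lambda>t. rtail (f t) q) \<in> borel_measurable M)"
proof (intro iffI conjI)
  assume f: "f \<in> M \<rightarrow>\<^sub>M borel_probs_algebra"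
  show "\<forall>t\<in>space M. f t \<in> borel_probs"
    using measurable_space[OF f] by simp
  show "\<forall>q. (\<lambda>t. rtail (f t) q) \<in> borel_measurable M"
    using measurable_compose[OF f measurable_tail] by simp
next
  assume *: "(\<forall>t\<in>space M. f t \<in> borel_probs) \<and> (\<forall>q. (\<lambda>t. rtail (f t) q) \<in> borel_measurable M)"
  then have meas: "(\<lambda>t. rtail (f t)) \<in> borel_measurable M"
    by (intro measurable_coordinatewise_then_product) auto
  show "f \<in> M \<rightarrow>\<^sub>M borel_probs_algebra"
    unfolding borel_probs_algebra_def
  proof (rule measurable_measure_of[OF borel_probs_algebra_Pow])
    fix U assume "U \<in> {U. openin weak_topology U}"
    then obtain V :: "(rat \<Rightarrow> real) set"
      where V: "open V" "U = {\<mu> \<in> borel_probs. rtail \<mu> \<in> V}"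
      using openin_weak_topology_rtail by blast
    have "f -` U \<inter> space M = (\<lambda>t. rtail (f t)) -` V \<inter> space M"
      using * by (auto simp: V(2))
    also have "\<dots> \<in> sets M" using meas V(1) by (auto intro: measurable_sets)
    finally show "f -` U \<inter> space M \<in> sets M" .
  qed (use * in auto)
qed

lemma borel_measurable_rat_closure:
  assumes "\<And>q. (\<lambda>t. G t q) \<in> borel_measurable M"
    and "\<And>t. t \<in> space M \<Longrightarrow> bdd_above (range (G t))"
  shows "(\<lambda>t. rat_closure (G t) s) \<in> borel_measurable M"
  unfolding rat_closure_def
  by (rule borel_measurable_cSUP) (auto intro: assms bdd_above_image_of_range)

subsection \<open>Countable essential suprema\<close>

text \<open>Exhaustion: a countable \<open>C\<close> maximising the weighted integral of \<open>SUP c\<in>C. X c\<close> cannot be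
  improved by adding one more index.\<close>

lemma (in sigma_finite_measure) countable_ess_sup:
  fixes X :: "'i \<Rightarrow> 'a \<Rightarrow> real"
  assumes ne: "A \<noteq> {}"
    and meas: "\<And>i. i \<in> A \<Longrightarrow> X i \<in> borel_measurable M"
    and bnd: "\<And>i x. i \<in> A \<Longrightarrow> x \<in> space M \<Longrightarrow> \<bar>X i x\<bar> \<le> B"
  shows "\<exists>C. C \<subseteq> A \<and> countable C \<and> C \<noteq> {} \<and> (\<forall>i\<in>A. AE x in M. X i x \<le> (SUP c\<in>C. X c x))"
proof -
  \<comment> \<open>Sigma-finiteness enters here. Integrability makes \<open>J\<close> finite and
    bounded on the class of countable subfamilies; strict positivity later lets \<open>w\<close> be
    cancelled pointwise.\<close>
  obtain w :: "'a \<Rightarrow> real" where w: "w \<in> borel_measurable M" "\<And>x. w x > 0" "integrable M w"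
    using obtain_positive_integrable_function by metis
  define \<C> where "\<C> = {C. C \<subseteq> A \<and> countable C \<and> C \<noteq> {}}"
  define S where "S C x = (SUP c\<in>C. X c x)" for C x
  define J where "J C = (\<integral>x. w x * S C x \<partial>M)" for C
  have bdd: "bdd_above ((\<lambda>c. X c x) ` C)" if "C \<in> \<C>" "x \<in> space M" for C x
  proof (rule bdd_aboveI2)
    fix c assume "c \<in> C"
    with that(1) have "c \<in> A" by (auto simp: \<C>_def)
    from bnd[OF this that(2)] show "X c x \<le> B" by simp
  qed
  have S_upper: "X c x \<le> S C x" if "C \<in> \<C>" "x \<in> space M" "c \<in> C" for C c x
    unfolding S_def by (rule cSUP_upper[OF that(3) bdd[OF that(1,2)]])
  have S_abs: "\<bar>S C x\<bar> \<le> B" if C: "C \<in> \<C>" and x: "x \<in> space M" for C x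
  proof -
    obtain c where c: "c \<in> C" using C by (auto simp: \<C>_def)
    have abs: "\<bar>X d x\<bar> \<le> B" if "d \<in> C" for d
      using that C by (intro bnd x) (auto simp: \<C>_def)
    have "S C x \<le> B"
      unfolding S_def by (rule cSUP_least) (use c abs in \<open>auto simp: abs_le_iff\<close>)
    moreover have "- B \<le> S C x"
      using S_upper[OF C x c] abs[OF c] by linarith
    ultimately show ?thesis by linarith
  qed
  have S_mono: "S C x \<le> S D x" if "C \<in> \<C>" "D \<in> \<C>" "C \<subseteq> D" "x \<in> space M" for C D x
    unfolding S_def[of C] by (rule cSUP_least) (use that S_upper in \<open>auto simp: \<C>_def\<close>)
  have S_meas: "S C \<in> borel_measurable M" if "C \<in> \<C>" for C
    unfolding S_def
    by (rule borel_measurable_cSUP) (use that meas bdd in \<open>auto simp: \<C>_def\<close>)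
  have int: "integrable M (\<lambda>x. w x * S C x)" if C: "C \<in> \<C>" for C
  proof (rule Bochner_Integration.integrable_bound[where f="\<lambda>x. w x * B"])
    show "AE x in M. norm (w x * S C x) \<le> norm (w x * B)"
    proof (rule AE_I2)
      fix x assume "x \<in> space M"
      from S_abs[OF C this] show "norm (w x * S C x) \<le> norm (w x * B)"
        using w(2)[of x] by (auto simp: abs_mult intro!: mult_left_mono)
    qed
  qed (use w S_meas[OF C] in auto)
  have J_mono: "J C \<le> J D" if "C \<in> \<C>" "D \<in> \<C>" "C \<subseteq> D" for C D
    unfolding J_def
    by (rule integral_mono[OF int int])
       (use that S_mono w(2) in \<open>auto intro!: mult_left_mono simp: less_imp_le\<close>)
  have J_le: "J C \<le> (\<integral>x. w x * B \<partial>M)" if C: "C \<in> \<C>" for C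
    unfolding J_def
  proof (rule integral_mono[OF int[OF C]])
    fix x assume "x \<in> space M"
    from S_abs[OF C this] show "w x * S C x \<le> w x * B"
      using w(2)[of x] by (auto intro!: mult_left_mono)
  qed (use w in auto)
  have bddJ: "bdd_above (J ` \<C>)"
    by (rule bdd_aboveI2) (rule J_le)
  have \<C>_ne: "\<C> \<noteq> {}"
  proof -
    obtain a where "a \<in> A" using ne by blast
    then have "{a} \<in> \<C>" by (simp add: \<C>_def)
    then show ?thesis by blast
  qed
  define j where "j = (SUP C\<in>\<C>. J C)"
  have "\<exists>C\<in>\<C>. j - 1 / real (Suc n) < J C" for n
  proof -
    have "j - 1 / real (Suc n) < (SUP C\<in>\<C>. J C)" by (simp add: j_def)
    then show ?thesis by (simp add: less_cSUP_iff[OF \<C>_ne bddJ])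
  qed
  then obtain D where D: "\<And>n. D n \<in> \<C>" "\<And>n. j - 1 / real (Suc n) < J (D n)"
    by metis
  \<comment> \<open>The admissible subfamilies are closed under countable unions, so the union of
    near-maximisers is admissible and attains the supremum \<open>j\<close>.\<close>
  define C where "C = (\<Union>n. D n)"
  have C: "C \<in> \<C>" using D(1) by (auto simp: C_def \<C>_def)
  have jC: "j \<le> J C"
  proof (rule LIMSEQ_le_const2)
    show "(\<lambda>n. j - 1 / real (Suc n)) \<longlonglongrightarrow> j"
      using tendsto_diff[OF tendsto_const LIMSEQ_Suc[OF lim_1_over_n], of j] by simp
    have "j - 1 / real (Suc n) \<le> J C" for n
    proof -
      have "D n \<subseteq> C" by (auto simp: C_def)
      from D(2)[of n] J_mono[OF D(1) C this] show ?thesis by linarith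
    qed
    then show "\<exists>N. \<forall>n\<ge>N. j - 1 / real (Suc n) \<le> J C" by blast
  qed
  have "AE x in M. X i x \<le> S C x" if i: "i \<in> A" for i
  proof -
    have iC: "insert i C \<in> \<C>" using C i by (auto simp: \<C>_def)
    have "J (insert i C) \<le> j" unfolding j_def by (rule cSUP_upper[OF iC bddJ])
    with jC J_mono[OF C iC subset_insertI] have eq: "J (insert i C) = J C" by linarith
    \<comment> \<open>The integrand is nonnegative because \<open>C\<close> is contained in
      \<open>insert i C\<close>, and its integral vanishes by maximality of
      \<open>C\<close>.\<close>
    have "AE x in M. w x * S (insert i C) x - w x * S C x = 0"
    proof (subst integral_nonneg_eq_0_iff_AE[symmetric])
      show "AE x in M. 0 \<le> w x * S (insert i C) x - w x * S C x"
      proof (rule AE_I2)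
        fix x assume "x \<in> space M"
        from S_mono[OF C iC _ this]
        show "0 \<le> w x * S (insert i C) x - w x * S C x"
          using w(2)[of x] by (auto intro!: mult_left_mono)
      qed
    qed (use int[OF C] int[OF iC] eq in \<open>auto simp: J_def\<close>)
    with AE_space show ?thesis
    proof eventually_elim
      case (elim x)
      then have "S (insert i C) x = S C x" using w(2)[of x] by simp
      with S_upper[OF iC elim(1), of i] show ?case by simp
    qed
  qed
  with C show ?thesis by (auto simp: \<C>_def S_def intro!: exI[of _ C])
qed

text \<open>Uniting the subfamilies found for the separate \<open>q\<close> keeps them countable and
  can only raise each supremum; the null sets are united over the countable index type as
  well.\<close>

lemma (in sigma_finite_measure) countable_ess_sup_simultaneous:
  fixes X :: "'q::countable \<Rightarrow> 'i \<Rightarrow> 'a \<Rightarrow> real"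
  assumes ne: "A \<noteq> {}"
    and meas: "\<And>q i. i \<in> A \<Longrightarrow> X q i \<in> borel_measurable M"
    and bnd: "\<And>q i x. i \<in> A \<Longrightarrow> x \<in> space M \<Longrightarrow> \<bar>X q i x\<bar> \<le> B"
  shows "\<exists>C. C \<subseteq> A \<and> countable C \<and> C \<noteq> {} \<and>
    (\<forall>i\<in>A. AE x in M. \<forall>q. X q i x \<le> (SUP c\<in>C. X q c x))"
proof -
  have "\<forall>q. \<exists>C. C \<subseteq> A \<and> countable C \<and> C \<noteq> {} \<and> (\<forall>i\<in>A. AE x in M. X q i x \<le> (SUP c\<in>C. X q c x))"
    by (intro allI countable_ess_sup[OF ne meas bnd])
  then obtain D where D: "\<And>q. D q \<subseteq> A" "\<And>q. countable (D q)" "\<And>q. D q \<noteq> {}"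
    "\<And>q i. i \<in> A \<Longrightarrow> AE x in M. X q i x \<le> (SUP c\<in>D q. X q c x)"
    by metis
  define C where "C = (\<Union>q. D q)"
  have C: "C \<subseteq> A" "countable C" "C \<noteq> {}"
    using D(1-3) by (auto simp: C_def)
  have "AE x in M. \<forall>q. X q i x \<le> (SUP c\<in>C. X q c x)" if "i \<in> A" for i
    unfolding AE_all_countable
  proof
    fix q
    from D(4)[OF that, of q] AE_space show "AE x in M. X q i x \<le> (SUP c\<in>C. X q c x)"
    proof eventually_elim
      case (elim x)
      have "(SUP c\<in>D q. X q c x) \<le> (SUP c\<in>C. X q c x)"
      proof (rule cSUP_subset_mono[OF D(3)])
        show "bdd_above ((\<lambda>c. X q c x) ` C)"
        proof (rule bdd_aboveI2)
          fix c assume "c \<in> C"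
          with C(1) have "c \<in> A" by blast
          from bnd[OF this elim(2)] show "X q c x \<le> B" by (simp add: abs_le_iff)
        qed
      qed (auto simp: C_def)
      with elim(1) show ?case by simp
    qed
  qed
  with C show ?thesis by blast
qed

subsection \<open>Essential suprema of families of random probability measures\<close>

text \<open>The sign \<open>\<sigma> = \<plusminus>1\<close> treats the stochastic order and its dual simultaneously.\<close>

definition st_le_sgn :: "real \<Rightarrow> real measure \<Rightarrow> real measure \<Rightarrow> bool" where
  "st_le_sgn \<sigma> \<mu> \<nu> \<longleftrightarrow> (\<forall>q. \<sigma> * rtail \<mu> q \<le> \<sigma> * rtail \<nu> q)"

lemma st_le_sgn_trans: "st_le_sgn \<sigma> \<mu> \<nu> \<Longrightarrow> st_le_sgn \<sigma> \<nu> \<rho> \<Longrightarrow> st_le_sgn \<sigma> \<mu> \<rho>"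
  unfolding st_le_sgn_def by (meson order_trans)

lemma st_le_sgn_simps:
  assumes "\<mu> \<in> borel_probs" "\<nu> \<in> borel_probs"
  shows "st_le_sgn 1 \<mu> \<nu> \<longleftrightarrow> \<mu> \<le>\<^sub>s\<^sub>t \<nu>" "st_le_sgn (- 1) \<mu> \<nu> \<longleftrightarrow> \<nu> \<le>\<^sub>s\<^sub>t \<mu>"
  using assms by (simp_all add: st_le_sgn_def st_le_iff_rtail)

text \<open>\<open>h\<close> and \<open>G\<close> may differ even at rationals, yet comparisons of
  \<open>G\<close> with a measure pass to \<open>h\<close>: regularise both sides and use that the
  tails of \<open>k\<close> are fixed.\<close>

lemma st_le_sgn_rat_closure:
  assumes \<sigma>: "\<sigma> \<in> {1, - 1}" and bdd: "bdd_above (range G)"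
    and h: "\<And>s. tail h s = rat_closure G s" and k: "k \<in> borel_probs"
  shows "(\<And>q. \<sigma> * rtail k q \<le> \<sigma> * G q) \<Longrightarrow> st_le_sgn \<sigma> k h"
    and "(\<And>q. \<sigma> * G q \<le> \<sigma> * rtail k q) \<Longrightarrow> st_le_sgn \<sigma> h k"
proof -
  have le: "tail k s \<le> tail h s" if "\<And>q. rtail k q \<le> G q" for s
    using rat_closure_mono[OF bdd that, of s] by (simp add: h rat_closure_rtail[OF k])
  have ge: "tail h s \<le> tail k s" if "\<And>q. G q \<le> rtail k q" for s
    using rat_closure_mono[OF bdd_above_rtail[OF k] that, of s] by (simp add: h rat_closure_rtail[OF k])
  show "(\<And>q. \<sigma> * rtail k q \<le> \<sigma> * G q) \<Longrightarrow> st_le_sgn \<sigma> k h"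
    and "(\<And>q. \<sigma> * G q \<le> \<sigma> * rtail k q) \<Longrightarrow> st_le_sgn \<sigma> h k"
    using \<sigma> le ge by (auto simp: st_le_sgn_def)
qed

text \<open>Choosing \<open>h t\<close> separately for each \<open>t\<close> causes no measurability
  problem, because its tails are prescribed by a countable supremum of measurable functions.\<close>

lemma ex_random_prob_of_rat_closure:
  assumes f: "f \<in> M \<rightarrow>\<^sub>M borel_probs_algebra" and g: "g \<in> M \<rightarrow>\<^sub>M borel_probs_algebra"
    and meas: "\<And>q. (\<lambda>t. G t q) \<in> borel_measurable M"
    and anti: "\<And>t p q. t \<in> space M \<Longrightarrow> p \<le> q \<Longrightarrow> G t q \<le> G t p"
    and lower: "\<And>t q. t \<in> space M \<Longrightarrow> min (rtail (f t) q) (rtail (g t) q) \<le> G t q"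
    and upper: "\<And>t q. t \<in> space M \<Longrightarrow> G t q \<le> max (rtail (f t) q) (rtail (g t) q)"
  shows "\<exists>h. h \<in> M \<rightarrow>\<^sub>M borel_probs_algebra \<and>
    (\<forall>t\<in>space M. bdd_above (range (G t)) \<and> (\<forall>s. tail (h t) s = rat_closure (G t) s))"
proof -
  have prob: "f t \<in> borel_probs" "g t \<in> borel_probs" if "t \<in> space M" for t
    using f g that by (simp_all add: measurable_borel_probs_algebra_iff)
  have "\<exists>\<mu>\<in>borel_probs. \<forall>s. tail \<mu> s = rat_closure (G t) s" if "t \<in> space M" for t
    using ex_prob_of_rat_closure[OF anti[OF that] prob[OF that] lower[OF that] upper[OF that]] .
  then obtain h where h: "\<And>t. t \<in> space M \<Longrightarrow> h t \<in> borel_probs"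
    "\<And>t s. t \<in> space M \<Longrightarrow> tail (h t) s = rat_closure (G t) s"
    by metis
  have bdd: "bdd_above (range (G t))" if t: "t \<in> space M" for t
  proof (rule bdd_aboveI2)
    show "G t q \<le> 1" for q
      using upper[OF t, of q] tail_bounds(2)[OF prob(1)[OF t]] tail_bounds(2)[OF prob(2)[OF t]]
      by (meson max.bounded_iff order_trans)
  qed
  have "(\<lambda>t. rtail (h t) q) \<in> borel_measurable M" for q
    by (subst measurable_cong[OF h(2)])
       (auto intro: borel_measurable_rat_closure meas bdd)
  with h bdd show ?thesis
    by (intro exI[of _ h]) (simp add: measurable_borel_probs_algebra_iff)
qed

text \<open>Supplies the bound that a pair needs before the essential supremum can be applied to it;
  binary joins and meets come from there.\<close>

lemma ex_random_upper_bound: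
  assumes \<sigma>: "\<sigma> \<in> {1, - 1}"
    and f: "f \<in> M \<rightarrow>\<^sub>M borel_probs_algebra" and g: "g \<in> M \<rightarrow>\<^sub>M borel_probs_algebra"
  shows "\<exists>h. h \<in> M \<rightarrow>\<^sub>M borel_probs_algebra \<and>
    (\<forall>t\<in>space M. st_le_sgn \<sigma> (f t) (h t) \<and> st_le_sgn \<sigma> (g t) (h t))"
proof -
  \<comment> \<open>Multiplying by \<sigma> inside and outside turns this into the maximum of the
    tails for sign 1 and their minimum for sign -1.\<close>
  let ?G = "\<lambda>t q. \<sigma> * max (\<sigma> * rtail (f t) q) (\<sigma> * rtail (g t) q)"
  have prob: "f t \<in> borel_probs" "g t \<in> borel_probs" if "t \<in> space M" for t
    using f g that by (simp_all add: measurable_borel_probs_algebra_iff)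
  have meas: "(\<lambda>t. rtail (f t) q) \<in> borel_measurable M" "(\<lambda>t. rtail (g t) q) \<in> borel_measurable M" for q
    using f g by (simp_all add: measurable_borel_probs_algebra_iff)
  have "\<exists>h. h \<in> M \<rightarrow>\<^sub>M borel_probs_algebra \<and>
    (\<forall>t\<in>space M. bdd_above (range (?G t)) \<and> (\<forall>s. tail (h t) s = rat_closure (?G t) s))"
  proof (rule ex_random_prob_of_rat_closure[OF f g])
    show "(\<lambda>t. ?G t q) \<in> borel_measurable M" for q
      using meas by measurable
    fix t p q assume t: "t \<in> space M"
    show "min (rtail (f t) q) (rtail (g t) q) \<le> ?G t q" "?G t q \<le> max (rtail (f t) q) (rtail (g t) q)"
      using \<sigma> by auto
    assume "p \<le> (q :: rat)"
    then have "rtail (f t) q \<le> rtail (f t) p" "rtail (g t) q \<le> rtail (g t) p"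
      by (simp_all add: tail_antimono prob t of_rat_less_eq)
    then show "?G t q \<le> ?G t p" using \<sigma> by auto
  qed
  then obtain h where h: "h \<in> M \<rightarrow>\<^sub>M borel_probs_algebra"
    and closure: "\<forall>t\<in>space M. bdd_above (range (?G t)) \<and> (\<forall>s. tail (h t) s = rat_closure (?G t) s)"
    by (elim exE conjE)
  note bddG = bspec[OF closure, THEN conjunct1]
    and tail_h = bspec[OF closure, THEN conjunct2, THEN spec]
  have \<sigma>\<sigma>: "\<sigma> * (\<sigma> * x) = x" for x using \<sigma> by auto
  have "st_le_sgn \<sigma> (f t) (h t)" "st_le_sgn \<sigma> (g t) (h t)" if t: "t \<in> space M" for t
  proof -
    note le = st_le_sgn_rat_closure(1)[OF \<sigma> bddG[OF t] tail_h[OF t]]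
    show "st_le_sgn \<sigma> (f t) (h t)"
      by (rule le[OF prob(1)[OF t]]) (simp add: \<sigma>\<sigma>)
    show "st_le_sgn \<sigma> (g t) (h t)"
      by (rule le[OF prob(2)[OF t]]) (simp add: \<sigma>\<sigma>)
  qed
  with h show ?thesis by blast
qed

text \<open>The bounds \<open>F i \<le> g\<close> hold only almost everywhere; truncating at \<open>g\<close> makes the pointwise
  supremum a tail function for every \<open>t\<close>.\<close>

lemma (in sigma_finite_measure) ex_random_sup:
  fixes F :: "'i \<Rightarrow> 'a \<Rightarrow> real measure"
  assumes \<sigma>: "\<sigma> \<in> {1, - 1}" and ne: "A \<noteq> {}"
    and F_meas: "\<forall>i\<in>A. F i \<in> M \<rightarrow>\<^sub>M borel_probs_algebra"
    and g: "g \<in> M \<rightarrow>\<^sub>M borel_probs_algebra"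
    and F_le: "\<forall>i\<in>A. AE t in M. st_le_sgn \<sigma> (F i t) (g t)"
  shows "\<exists>C h. C \<subseteq> A \<and> countable C \<and> C \<noteq> {} \<and> h \<in> M \<rightarrow>\<^sub>M borel_probs_algebra \<and>
    (\<forall>i\<in>A. AE t in M. st_le_sgn \<sigma> (F i t) (h t)) \<and>
    (\<forall>k. k \<in> M \<rightarrow>\<^sub>M borel_probs_algebra \<longrightarrow> (\<forall>c\<in>C. AE t in M. st_le_sgn \<sigma> (F c t) (k t)) \<longrightarrow>
       (AE t in M. st_le_sgn \<sigma> (h t) (k t))) \<and>
    (\<forall>i. (\<forall>n. i n \<in> A) \<longrightarrow> (\<forall>n. AE t in M. st_le_sgn \<sigma> (F (i n) t) (F (i (Suc n)) t)) \<longrightarrow>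
       (\<forall>c\<in>C. \<exists>n. AE t in M. st_le_sgn \<sigma> (F c t) (F (i n) t)) \<longrightarrow>
       (AE t in M. limitin weak_topology (\<lambda>n. F (i n) t) (h t) sequentially))"
proof -
  have \<sigma>\<sigma>: "\<sigma> * (\<sigma> * x) = x" for x using \<sigma> by auto
  note F = bspec[OF F_meas] and Fg = bspec[OF F_le]
  have prob: "F i t \<in> borel_probs" if "i \<in> A" "t \<in> space M" for i t
    using F[OF that(1)] that(2) by (simp add: measurable_borel_probs_algebra_iff)
  have gprob: "g t \<in> borel_probs" if "t \<in> space M" for t
    using g that by (simp add: measurable_borel_probs_algebra_iff)
  have meas: "(\<lambda>t. rtail (F i t) q) \<in> borel_measurable M" if "i \<in> A" for i q
    using F[OF that] by (simp add: measurable_borel_probs_algebra_iff)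
  have gmeas: "(\<lambda>t. rtail (g t) q) \<in> borel_measurable M" for q
    using g by (simp add: measurable_borel_probs_algebra_iff)
  let ?X = "\<lambda>q i t. \<sigma> * rtail (F i t) q"
  have abs1: "\<bar>?X q i t\<bar> \<le> 1" if "i \<in> A" "t \<in> space M" for q i t
    using tail_bounds[OF prob[OF that]] \<sigma> by auto
  obtain C where C: "C \<subseteq> A" "countable C" "C \<noteq> {}"
    and sup: "\<And>i. i \<in> A \<Longrightarrow> AE t in M. \<forall>q. ?X q i t \<le> (SUP c\<in>C. ?X q c t)"
  proof -
    have "?X q i \<in> borel_measurable M" if "i \<in> A" for q i
      by (intro borel_measurable_times borel_measurable_const meas that)
    from countable_ess_sup_simultaneous[where X="?X" and B=1, OF ne this abs1] that
    show thesis by blast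
  qed
  let ?Y = "\<lambda>t q c. min (?X q c t) (\<sigma> * rtail (g t) q)"
  \<comment> \<open>The outer sign undoes the inner one: for sign -1 this is the infimum of the
    tails, each truncated from below by that of \<open>g\<close>.\<close>
  let ?G = "\<lambda>t q. \<sigma> * (SUP c\<in>C. ?Y t q c)"
  have bddY: "bdd_above (?Y t q ` C)" for t q
    by (rule bdd_aboveI[where M="\<sigma> * rtail (g t) q"]) auto
  \<comment> \<open>A single member and \<open>g\<close> squeeze \<open>?G\<close>. The bound
    \<open>g\<close> lies above it for sign 1 and below it for sign -1, and \<open>c0\<close>
    controls the opposite side.\<close>
  obtain c0 where c0: "c0 \<in> C" using C(3) by blast
  have "\<exists>h. h \<in> M \<rightarrow>\<^sub>M borel_probs_algebra \<and>
    (\<forall>t\<in>space M. bdd_above (range (?G t)) \<and> (\<forall>s. tail (h t) s = rat_closure (?G t) s))"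
  proof (rule ex_random_prob_of_rat_closure[OF F[of c0] g])
    show "c0 \<in> A" using c0 C by blast
    have "(\<lambda>t. SUP c\<in>C. ?Y t q c) \<in> borel_measurable M" for q
    proof (rule borel_measurable_cSUP[OF C(2) _ bddY])
      fix c assume "c \<in> C"
      then have "c \<in> A" using C(1) by blast
      from meas[OF this] gmeas show "(\<lambda>t. ?Y t q c) \<in> borel_measurable M" by measurable
    qed
    then show "(\<lambda>t. ?G t q) \<in> borel_measurable M" for q by measurable
    fix t p q assume t: "t \<in> space M"
    have up: "(SUP c\<in>C. ?Y t q c) \<le> \<sigma> * rtail (g t) q"
      by (rule cSUP_least[OF C(3)]) simp
    have lo: "?Y t q c0 \<le> (SUP c\<in>C. ?Y t q c)"
      by (rule cSUP_upper[OF c0 bddY])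
    from up lo \<sigma>
    show "min (rtail (F c0 t) q) (rtail (g t) q) \<le> ?G t q"
      "?G t q \<le> max (rtail (F c0 t) q) (rtail (g t) q)"
      by auto
    assume pq: "p \<le> (q :: rat)"
    have anti: "rtail (F c t) q \<le> rtail (F c t) p" if "c \<in> C" for c
      using that C(1) pq by (intro tail_antimono prob t) (auto simp: of_rat_less_eq)
    have ganti: "rtail (g t) q \<le> rtail (g t) p"
      using pq by (intro tail_antimono gprob t) (auto simp: of_rat_less_eq)
    consider "\<sigma> = 1" | "\<sigma> = - 1" using \<sigma> by auto
    then show "?G t q \<le> ?G t p"
    proof cases
      case 1
      have "(SUP c\<in>C. ?Y t q c) \<le> (SUP c\<in>C. ?Y t p c)"
      proof (rule cSUP_mono[OF C(3) bddY])
        fix c assume c: "c \<in> C"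
        with anti[OF c] ganti 1 show "\<exists>m\<in>C. ?Y t q c \<le> ?Y t p m"
          by (intro bexI[of _ c]) auto
      qed
      with 1 show ?thesis by simp
    next
      case 2
      have "(SUP c\<in>C. ?Y t p c) \<le> (SUP c\<in>C. ?Y t q c)"
      proof (rule cSUP_mono[OF C(3) bddY])
        fix c assume c: "c \<in> C"
        with anti[OF c] ganti 2 show "\<exists>m\<in>C. ?Y t p c \<le> ?Y t q m"
          by (intro bexI[of _ c]) auto
      qed
      with 2 show ?thesis by simp
    qed
  qed
  then obtain h where h: "h \<in> M \<rightarrow>\<^sub>M borel_probs_algebra"
    and closure: "\<forall>t\<in>space M. bdd_above (range (?G t)) \<and> (\<forall>s. tail (h t) s = rat_closure (?G t) s)"
    by (elim exE conjE)
  note bddG = bspec[OF closure, THEN conjunct1]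
    and tail_h = bspec[OF closure, THEN conjunct2, THEN spec]
  have hprob: "h t \<in> borel_probs" if "t \<in> space M" for t
    using h that by (simp add: measurable_borel_probs_algebra_iff)
  have "AE t in M. \<forall>c\<in>C. st_le_sgn \<sigma> (F c t) (g t)"
    using C(1,2) Fg by (intro AE_ball_countable') auto
  \<comment> \<open>Countability of \<open>C\<close> gives one null set outside which the truncation
    is invisible for all \<open>c\<close> and \<open>q\<close> at once.\<close>
  with AE_space have YX: "AE t in M. \<forall>q. \<forall>c\<in>C. ?Y t q c = ?X q c t"
    by eventually_elim (auto simp: st_le_sgn_def min_def)
  have FG: "AE t in M. \<forall>q. ?X q i t \<le> \<sigma> * ?G t q" if "i \<in> A" for i
    using sup[OF that] YX by eventually_elim (simp add: \<sigma>\<sigma>)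
  have upper: "AE t in M. st_le_sgn \<sigma> (F i t) (h t)" if i: "i \<in> A" for i
    using FG[OF i] AE_space
  proof eventually_elim
    case (elim t)
    then show ?case
      by (intro st_le_sgn_rat_closure(1)[OF \<sigma> bddG[OF elim(2)] tail_h[OF elim(2)] prob[OF i elim(2)]]) simp
  qed
  have least: "AE t in M. st_le_sgn \<sigma> (h t) (k t)"
    if k: "k \<in> M \<rightarrow>\<^sub>M borel_probs_algebra" and Fk: "\<forall>c\<in>C. AE t in M. st_le_sgn \<sigma> (F c t) (k t)" for k
  proof -
    have "AE t in M. \<forall>c\<in>C. st_le_sgn \<sigma> (F c t) (k t)"
      using C(2) Fk by (intro AE_ball_countable') auto
    with YX AE_space show ?thesis
    proof eventually_elim
      case (elim t)
      have kp: "k t \<in> borel_probs"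
        using k elim by (simp add: measurable_borel_probs_algebra_iff)
      have "\<sigma> * ?G t q \<le> \<sigma> * rtail (k t) q" for q
        unfolding \<sigma>\<sigma> by (rule cSUP_least[OF C(3)]) (use elim in \<open>auto simp: st_le_sgn_def\<close>)
      then show ?case
        by (rule st_le_sgn_rat_closure(2)[OF \<sigma> bddG[OF elim(2)] tail_h[OF elim(2)] kp])
    qed
  qed
  \<comment> \<open>The convergence criterion is proved alongside the supremum because it needs the
    formula \<open>?G\<close> behind the tails of \<open>h\<close>, which the existential conclusion
    hides.\<close>
  have lim: "AE t in M. limitin weak_topology (\<lambda>n. F (i n) t) (h t) sequentially"
    if iA: "\<forall>n. i n \<in> A" and inc: "\<forall>n. AE t in M. st_le_sgn \<sigma> (F (i n) t) (F (i (Suc n)) t)"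
      and cof: "\<forall>c\<in>C. \<exists>n. AE t in M. st_le_sgn \<sigma> (F c t) (F (i n) t)" for i
  proof -
    obtain N where N: "\<And>c. c \<in> C \<Longrightarrow> AE t in M. st_le_sgn \<sigma> (F c t) (F (i (N c)) t)"
      using cof by metis
    have "AE t in M. \<forall>c\<in>C. st_le_sgn \<sigma> (F c t) (F (i (N c)) t)"
      using C(2) N by (intro AE_ball_countable') auto
    moreover have "AE t in M. \<forall>n. st_le_sgn \<sigma> (F (i n) t) (F (i (Suc n)) t)"
      using inc by (simp add: AE_all_countable)
    moreover have "AE t in M. \<forall>n q. ?X q (i n) t \<le> \<sigma> * ?G t q"
      using FG iA by (simp add: AE_all_countable)
    moreover note YX AE_space
    ultimately show ?thesis
    proof eventually_elim
      case (elim t)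
      have "(\<lambda>n. rtail (F (i n) t) q) \<longlonglongrightarrow> ?G t q" for q
      proof -
        \<comment> \<open>From below, a member \<open>c\<close> exceeding \<open>x\<close> is
          dominated at index \<open>N c\<close>, and monotonicity preserves this afterwards; from
          above, each \<open>i n\<close> lies in \<open>A\<close> and so stays under the essential
          supremum.\<close>
        have "(\<lambda>n. ?X q (i n) t) \<longlonglongrightarrow> (SUP c\<in>C. ?Y t q c)"
        proof (rule order_tendstoI)
          fix x assume "x < (SUP c\<in>C. ?Y t q c)"
          then obtain c where c: "c \<in> C" "x < ?Y t q c"
            by (subst (asm) less_cSUP_iff[OF C(3) bddY]) blast
          then have "x < ?X q (i (N c)) t"
            using elim(1) by (auto simp: st_le_sgn_def intro: less_le_trans)
          moreover have "?X q (i (N c)) t \<le> ?X q (i n) t" if "N c \<le> n" for n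
            by (rule lift_Suc_mono_le[of "\<lambda>n. ?X q (i n) t", OF _ that])
               (use elim(2) in \<open>auto simp: st_le_sgn_def\<close>)
          ultimately show "\<forall>\<^sub>F n in sequentially. x < ?X q (i n) t"
            by (intro eventually_sequentiallyI[of "N c"]) (blast intro: less_le_trans)
        next
          fix x assume "(SUP c\<in>C. ?Y t q c) < x"
          then show "\<forall>\<^sub>F n in sequentially. ?X q (i n) t < x"
            using elim(3) unfolding \<sigma>\<sigma> by (intro always_eventually) (blast intro: le_less_trans)
        qed
        from tendsto_mult[OF tendsto_const[of \<sigma>] this] show ?thesis by (simp only: \<sigma>\<sigma>)
      qed
      then show ?case
        by (rule limitin_weak_topologyI[rotated 2])
           (use elim iA prob hprob tail_h in auto)
    qed
  qed
  show ?thesis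
    by (intro exI[of _ C] exI[of _ h] conjI C h ballI allI impI upper least lim) blast+
qed

subsection \<open>The ordered set of equivalence classes\<close>

text \<open>Sign -1 unfolds to the dual order \<open>inv_gorder\<close>, so one statement about
  suprema yields the one about infima by specialisation.\<close>

definition L0_sgn :: "real \<Rightarrow> 'a measure \<Rightarrow> ('a \<Rightarrow> real measure) set gorder" where
  "L0_sgn \<sigma> \<pi> = \<lparr>carrier = L0_space \<pi>, eq = (=),
     le = (\<lambda>\<mu> \<nu>. if \<sigma> = 1 then L0_le \<pi> \<mu> \<nu> else L0_le \<pi> \<nu> \<mu>)\<rparr>"

lemma L0_sgn_simps: "L0_sgn 1 \<pi> = L0_st \<pi>" "L0_sgn (- 1) \<pi> = inv_gorder (L0_st \<pi>)"
  by (simp_all add: L0_sgn_def L0_st_def)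

lemma L0_space_eq_carrier: "L0_space \<pi> = carrier (L0_st \<pi>)"
  by (simp add: L0_st_def)

lemma carrier_L0_sgn [simp]: "carrier (L0_sgn \<sigma> \<pi>) = L0_space \<pi>"
  by (simp add: L0_sgn_def)

lemma L0_space_measurable:
  assumes "\<mu> \<in> L0_space \<pi>" "f \<in> \<mu>"
  shows "f \<in> \<pi> \<rightarrow>\<^sub>M borel_probs_algebra"
  using assms in_quotient_imp_subset[OF equiv_L0_rel] unfolding L0_space_def by blast

lemma ex_L0_space_rep: "\<mu> \<in> L0_space \<pi> \<Longrightarrow> \<exists>f. f \<in> \<mu>"
  using in_quotient_imp_non_empty[OF equiv_L0_rel] unfolding L0_space_def by blast

lemma ex_L0_class:
  assumes "f \<in> \<pi> \<rightarrow>\<^sub>M borel_probs_algebra"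
  shows "\<exists>\<mu>\<in>L0_space \<pi>. f \<in> \<mu>"
  unfolding L0_space_def
  using quotientI[OF assms] equiv_class_self[OF equiv_L0_rel assms] by blast

lemma L0_space_eqI:
  assumes "\<mu> \<in> L0_space \<pi>" "\<nu> \<in> L0_space \<pi>" "f \<in> \<mu>" "g \<in> \<nu>" "AE t in \<pi>. f t = g t"
  shows "\<mu> = \<nu>"
proof -
  have "(f, g) \<in> L0_rel \<pi>"
    using assms L0_space_measurable by (auto simp: L0_rel_def)
  then show ?thesis
    using quotient_eqI[OF equiv_L0_rel] assms(1-4) unfolding L0_space_def by blast
qed

lemma le_L0_sgn_iff:
  assumes \<sigma>: "\<sigma> \<in> {1, - 1}"
    and \<mu>: "\<mu> \<in> L0_space \<pi>" "f \<in> \<mu>" and \<nu>: "\<nu> \<in> L0_space \<pi>" "g \<in> \<nu>"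
  shows "\<mu> \<sqsubseteq>\<^bsub>L0_sgn \<sigma> \<pi>\<^esub> \<nu> \<longleftrightarrow> (AE t in \<pi>. st_le_sgn \<sigma> (f t) (g t))"
proof -
  have prob: "f t \<in> borel_probs" "g t \<in> borel_probs" if "t \<in> space \<pi>" for t
    using L0_space_measurable[OF \<mu>] L0_space_measurable[OF \<nu>] that
    by (simp_all add: measurable_borel_probs_algebra_iff)
  consider "\<sigma> = 1" | "\<sigma> = - 1" using \<sigma> by blast
  then show ?thesis
  proof cases
    case 1
    have "(AE t in \<pi>. st_le_sgn 1 (f t) (g t)) \<longleftrightarrow> (AE t in \<pi>. f t \<le>\<^sub>s\<^sub>t g t)"
      by (rule AE_cong) (simp add: st_le_sgn_simps prob)
    then show ?thesis
      using L0_le_iff[OF \<mu>(1) \<nu>(1) \<mu>(2) \<nu>(2)] 1 by (simp add: L0_sgn_def)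
  next
    case 2
    have "(AE t in \<pi>. st_le_sgn (- 1) (f t) (g t)) \<longleftrightarrow> (AE t in \<pi>. g t \<le>\<^sub>s\<^sub>t f t)"
      by (rule AE_cong) (simp add: st_le_sgn_simps prob)
    then show ?thesis
      using L0_le_iff[OF \<nu>(1) \<mu>(1) \<nu>(2) \<mu>(2)] 2 by (simp add: L0_sgn_def)
  qed
qed

text \<open>Antisymmetry is where the quotient matters: mutual domination gives equal rational tails
  off a null set, hence equal measures there and equal classes.\<close>

lemma partial_order_L0_sgn:
  assumes \<sigma>: "\<sigma> \<in> {1, - 1}"
  shows "partial_order (L0_sgn \<sigma> \<pi>)"
proof -
  let ?L = "L0_sgn \<sigma> \<pi>"
  have eq: "(.=\<^bsub>?L\<^esub>) = (=)" by (simp add: L0_sgn_def)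
  have refl: "\<mu> \<sqsubseteq>\<^bsub>?L\<^esub> \<mu>" if \<mu>: "\<mu> \<in> L0_space \<pi>" for \<mu>
  proof -
    obtain f where "f \<in> \<mu>" using ex_L0_space_rep[OF \<mu>] by blast
    then show ?thesis
      using le_L0_sgn_iff[OF \<sigma> \<mu> _ \<mu>, of f f] by (simp add: st_le_sgn_def)
  qed
  have antisym: "\<mu> = \<nu>"
    if le: "\<mu> \<sqsubseteq>\<^bsub>?L\<^esub> \<nu>" "\<nu> \<sqsubseteq>\<^bsub>?L\<^esub> \<mu>" and in_L: "\<mu> \<in> L0_space \<pi>" "\<nu> \<in> L0_space \<pi>" for \<mu> \<nu>
  proof -
    obtain f g where fg: "f \<in> \<mu>" "g \<in> \<nu>" using in_L[THEN ex_L0_space_rep] by (elim exE)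
    have prob: "f t \<in> borel_probs" "g t \<in> borel_probs" if "t \<in> space \<pi>" for t
      using L0_space_measurable[OF in_L(1) fg(1)] L0_space_measurable[OF in_L(2) fg(2)] that
      by (simp_all add: measurable_borel_probs_algebra_iff)
    have "AE t in \<pi>. st_le_sgn \<sigma> (f t) (g t)" "AE t in \<pi>. st_le_sgn \<sigma> (g t) (f t)"
      using le le_L0_sgn_iff[OF \<sigma> in_L(1) fg(1) in_L(2) fg(2)]
        le_L0_sgn_iff[OF \<sigma> in_L(2) fg(2) in_L(1) fg(1)] by simp_all
    with AE_space have "AE t in \<pi>. f t = g t"
    proof eventually_elim
      case (elim t)
      have "rtail (f t) q = rtail (g t) q" for q
        using elim(2,3) \<sigma> unfolding st_le_sgn_def by (auto intro: antisym)
      then show ?case by (rule borel_probs_eqI[OF prob[OF elim(1)]])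
    qed
    then show ?thesis by (rule L0_space_eqI[OF in_L fg])
  qed
  have trans: "\<mu> \<sqsubseteq>\<^bsub>?L\<^esub> \<rho>"
    if le: "\<mu> \<sqsubseteq>\<^bsub>?L\<^esub> \<nu>" "\<nu> \<sqsubseteq>\<^bsub>?L\<^esub> \<rho>"
      and in_L: "\<mu> \<in> L0_space \<pi>" "\<nu> \<in> L0_space \<pi>" "\<rho> \<in> L0_space \<pi>" for \<mu> \<nu> \<rho>
  proof -
    obtain f g h where fgh: "f \<in> \<mu>" "g \<in> \<nu>" "h \<in> \<rho>"
      using in_L[THEN ex_L0_space_rep] by (elim exE)
    have "AE t in \<pi>. st_le_sgn \<sigma> (f t) (g t)" "AE t in \<pi>. st_le_sgn \<sigma> (g t) (h t)"
      using le le_L0_sgn_iff[OF \<sigma> in_L(1) fgh(1) in_L(2) fgh(2)]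
        le_L0_sgn_iff[OF \<sigma> in_L(2) fgh(2) in_L(3) fgh(3)] by simp_all
    then have "AE t in \<pi>. st_le_sgn \<sigma> (f t) (h t)"
      by eventually_elim (rule st_le_sgn_trans)
    then show ?thesis
      using le_L0_sgn_iff[OF \<sigma> in_L(1) fgh(1) in_L(3) fgh(3)] by simp
  qed
  show ?thesis
    by (unfold_locales, unfold eq carrier_L0_sgn)
       (simp | rule refl | (rule antisym; assumption) | (rule trans; assumption))+
qed

lemma ex_L0_sgn_upper_bound:
  assumes \<sigma>: "\<sigma> \<in> {1, - 1}" and in_L: "\<mu> \<in> L0_space \<pi>" "\<nu> \<in> L0_space \<pi>"
  shows "bounded_above (L0_sgn \<sigma> \<pi>) {\<mu>, \<nu>}"
proof -
  obtain f g where fg: "f \<in> \<mu>" "g \<in> \<nu>" using in_L[THEN ex_L0_space_rep] by (elim exE)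
  obtain h where h: "h \<in> \<pi> \<rightarrow>\<^sub>M borel_probs_algebra"
    "\<And>t. t \<in> space \<pi> \<Longrightarrow> st_le_sgn \<sigma> (f t) (h t) \<and> st_le_sgn \<sigma> (g t) (h t)"
    using ex_random_upper_bound[OF \<sigma> L0_space_measurable[OF in_L(1) fg(1)] L0_space_measurable[OF in_L(2) fg(2)]]
    by blast
  obtain \<rho> where \<rho>: "\<rho> \<in> L0_space \<pi>" "h \<in> \<rho>" using ex_L0_class[OF h(1)] by blast
  have "\<mu> \<sqsubseteq>\<^bsub>L0_sgn \<sigma> \<pi>\<^esub> \<rho>" "\<nu> \<sqsubseteq>\<^bsub>L0_sgn \<sigma> \<pi>\<^esub> \<rho>"
    using h(2) le_L0_sgn_iff[OF \<sigma> in_L(1) fg(1) \<rho>] le_L0_sgn_iff[OF \<sigma> in_L(2) fg(2) \<rho>]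
    by auto
  then have "\<rho> \<in> Upper (L0_sgn \<sigma> \<pi>) {\<mu>, \<nu>}"
    using \<rho>(1) by (auto intro!: Upper_memI)
  then show ?thesis by (auto simp: bounded_above_def)
qed

text \<open>Transfers the essential supremum from functions to classes. The convergence clause asks
  a sequence only to be increasing and to dominate each member of \<open>C\<close>, which is what
  directedness can provide.\<close>

lemma L0_sgn_countable_sup:
  assumes "sigma_finite_measure \<pi>" and \<sigma>: "\<sigma> \<in> {1, - 1}"
    and A: "A \<subseteq> L0_space \<pi>" "A \<noteq> {}" and bdd: "bounded_above (L0_sgn \<sigma> \<pi>) A"
  shows "\<exists>s C. least (L0_sgn \<sigma> \<pi>) s (Upper (L0_sgn \<sigma> \<pi>) A) \<and>
    C \<subseteq> A \<and> countable C \<and> C \<noteq> {} \<and> least (L0_sgn \<sigma> \<pi>) s (Upper (L0_sgn \<sigma> \<pi>) C) \<and>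
    (\<forall>\<mu>. (\<forall>n. \<mu> n \<in> A) \<longrightarrow> (\<forall>n. \<mu> n \<sqsubseteq>\<^bsub>L0_sgn \<sigma> \<pi>\<^esub> \<mu> (Suc n)) \<longrightarrow>
       (\<forall>c\<in>C. \<exists>n. c \<sqsubseteq>\<^bsub>L0_sgn \<sigma> \<pi>\<^esub> \<mu> n) \<longrightarrow> weakly_ae \<pi> \<mu> s)"
proof -
  interpret sigma_finite_measure \<pi> by fact
  let ?L = "L0_sgn \<sigma> \<pi>"
  \<comment> \<open>One representative is fixed for every class, so that the classes themselves
    index the family of functions.\<close>
  obtain r where r: "\<And>\<mu>. \<mu> \<in> L0_space \<pi> \<Longrightarrow> r \<mu> \<in> \<mu>"
    using ex_L0_space_rep by metis
  have rA: "r \<mu> \<in> \<mu>" "\<mu> \<in> L0_space \<pi>" if "\<mu> \<in> A" for \<mu> using r A(1) that by blast+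
  have r_meas: "r \<mu> \<in> \<pi> \<rightarrow>\<^sub>M borel_probs_algebra" if "\<mu> \<in> L0_space \<pi>" for \<mu>
    using L0_space_measurable[OF that r[OF that]] .
  obtain u where u: "u \<in> L0_space \<pi>" "\<And>\<mu>. \<mu> \<in> A \<Longrightarrow> \<mu> \<sqsubseteq>\<^bsub>?L\<^esub> u"
    using bdd A(1) by (auto simp: bounded_above_def Upper_def)
  have le_iff: "\<mu> \<sqsubseteq>\<^bsub>?L\<^esub> \<nu> \<longleftrightarrow> (AE t in \<pi>. st_le_sgn \<sigma> (r \<mu> t) (r \<nu> t))"
    if "\<mu> \<in> L0_space \<pi>" "\<nu> \<in> L0_space \<pi>" for \<mu> \<nu>
    by (rule le_L0_sgn_iff[OF \<sigma> that(1) r[OF that(1)] that(2) r[OF that(2)]])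
  have r_le: "\<forall>\<mu>\<in>A. AE t in \<pi>. st_le_sgn \<sigma> (r \<mu> t) (r u t)"
    using u(2) le_iff[OF rA(2) u(1)] by blast
  have rA_meas: "\<forall>\<mu>\<in>A. r \<mu> \<in> \<pi> \<rightarrow>\<^sub>M borel_probs_algebra"
    using r_meas[OF rA(2)] by blast
  obtain C h where C: "C \<subseteq> A" "countable C" "C \<noteq> {}"
    and h: "h \<in> \<pi> \<rightarrow>\<^sub>M borel_probs_algebra"
    and upper: "\<forall>\<mu>\<in>A. AE t in \<pi>. st_le_sgn \<sigma> (r \<mu> t) (h t)"
    and least: "\<forall>k. k \<in> \<pi> \<rightarrow>\<^sub>M borel_probs_algebra \<longrightarrow>
      (\<forall>c\<in>C. AE t in \<pi>. st_le_sgn \<sigma> (r c t) (k t)) \<longrightarrow> (AE t in \<pi>. st_le_sgn \<sigma> (h t) (k t))"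
    and lim: "\<forall>i. (\<forall>n. i n \<in> A) \<longrightarrow> (\<forall>n. AE t in \<pi>. st_le_sgn \<sigma> (r (i n) t) (r (i (Suc n)) t)) \<longrightarrow>
      (\<forall>c\<in>C. \<exists>n. AE t in \<pi>. st_le_sgn \<sigma> (r c t) (r (i n) t)) \<longrightarrow>
      (AE t in \<pi>. limitin weak_topology (\<lambda>n. r (i n) t) (h t) sequentially)"
    using ex_random_sup[OF \<sigma> A(2) rA_meas r_meas[OF u(1)] r_le] by (elim exE conjE)
  obtain s where s: "s \<in> L0_space \<pi>" "h \<in> s" using ex_L0_class[OF h] by blast
  have s_upper: "\<mu> \<sqsubseteq>\<^bsub>?L\<^esub> s" if "\<mu> \<in> A" for \<mu>
    using upper that le_L0_sgn_iff[OF \<sigma> rA(2,1)[OF that] s] by blast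
  have s_least: "s \<sqsubseteq>\<^bsub>?L\<^esub> k" if k: "k \<in> L0_space \<pi>" and Ck: "\<And>c. c \<in> C \<Longrightarrow> c \<sqsubseteq>\<^bsub>?L\<^esub> k" for k
  proof -
    have "\<forall>c\<in>C. AE t in \<pi>. st_le_sgn \<sigma> (r c t) (r k t)"
      using Ck le_iff[OF rA(2) k] C(1) by blast
    with least r_meas[OF k] have "AE t in \<pi>. st_le_sgn \<sigma> (h t) (r k t)" by blast
    then show ?thesis using le_L0_sgn_iff[OF \<sigma> s k r[OF k]] by blast
  qed
  \<comment> \<open>Letting \<open>D\<close> range between \<open>C\<close> and \<open>A\<close>
    handles both required least upper bounds: domination is known for all of \<open>A\<close>,
    minimality already against bounds of \<open>C\<close>.\<close>
  have lub: "least ?L s (Upper ?L D)" if D: "C \<subseteq> D" "D \<subseteq> A" for D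
  proof (rule least_UpperI)
    show "s \<sqsubseteq>\<^bsub>?L\<^esub> k" if k: "k \<in> Upper ?L D" for k
    proof (rule s_least)
      show "k \<in> L0_space \<pi>" using k by (simp add: Upper_def)
      show "c \<sqsubseteq>\<^bsub>?L\<^esub> k" if "c \<in> C" for c
        using k that D A(1) by (auto simp: Upper_def)
    qed
  qed (use s(1) s_upper D A(1) in auto)
  have conv: "weakly_ae \<pi> \<mu> s"
    if \<mu>: "\<forall>n. \<mu> n \<in> A" "\<forall>n. \<mu> n \<sqsubseteq>\<^bsub>?L\<^esub> \<mu> (Suc n)" "\<forall>c\<in>C. \<exists>n. c \<sqsubseteq>\<^bsub>?L\<^esub> \<mu> n" for \<mu>
  proof -
    have \<mu>L: "\<mu> n \<in> L0_space \<pi>" for n using \<mu>(1) A(1) by blast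
    have "\<forall>n. AE t in \<pi>. st_le_sgn \<sigma> (r (\<mu> n) t) (r (\<mu> (Suc n)) t)"
      using \<mu>(2) le_iff[OF \<mu>L \<mu>L] by blast
    moreover have "\<forall>c\<in>C. \<exists>n. AE t in \<pi>. st_le_sgn \<sigma> (r c t) (r (\<mu> n) t)"
      using \<mu>(3) le_iff[OF rA(2) \<mu>L] C(1) by blast
    ultimately have "AE t in \<pi>. limitin weak_topology (\<lambda>n. r (\<mu> n) t) (h t) sequentially"
      using lim \<mu>(1) by blast
    then show ?thesis using weakly_ae_iff[of \<mu> \<pi> s "\<lambda>n. r (\<mu> n)" h] \<mu>L s r[OF \<mu>L] by blast
  qed
  show ?thesis
    by (intro exI[of _ s] exI[of _ C] conjI lub C conv allI impI order_refl) blast+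
qed

subsection \<open>Dedekind super completeness and monotone approximation\<close>

lemma L0_sgn_binary_sup:
  assumes "sigma_finite_measure \<pi>" "\<sigma> \<in> {1, - 1}" "\<mu> \<in> L0_space \<pi>" "\<nu> \<in> L0_space \<pi>"
  shows "\<exists>s. least (L0_sgn \<sigma> \<pi>) s (Upper (L0_sgn \<sigma> \<pi>) {\<mu>, \<nu>})"
  using L0_sgn_countable_sup[OF assms(1,2) _ _ ex_L0_sgn_upper_bound[OF assms(2-4)]] assms(3,4)
  by blast

text \<open>Meets are the binary suprema of sign -1, read in the dual order.\<close>

lemma lattice_L0_st:
  assumes "sigma_finite_measure \<pi>"
  shows "Lattice.lattice (L0_st \<pi>)"
proof -
  interpret partial_order "L0_st \<pi>"
    using partial_order_L0_sgn[of 1 \<pi>] by (simp add: L0_sgn_simps)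
  show ?thesis
  proof unfold_locales
    fix \<mu> \<nu> assume in_L: "\<mu> \<in> carrier (L0_st \<pi>)" "\<nu> \<in> carrier (L0_st \<pi>)"
    show "\<exists>s. least (L0_st \<pi>) s (Upper (L0_st \<pi>) {\<mu>, \<nu>})"
      using L0_sgn_binary_sup[OF assms, of 1 \<mu> \<nu>] in_L by (simp add: L0_sgn_simps L0_space_eq_carrier)
    show "\<exists>s. greatest (L0_st \<pi>) s (Lower (L0_st \<pi>) {\<mu>, \<nu>})"
      using L0_sgn_binary_sup[OF assms, of "- 1" \<mu> \<nu>] in_L by (simp add: L0_sgn_simps L0_space_eq_carrier)
  qed
qed

lemma Dedekind_super_complete_L0_st:
  assumes "sigma_finite_measure \<pi>"
  shows "Dedekind_super_complete (L0_st \<pi>)"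
proof -
  have sgn: "\<exists>s. least (L0_sgn \<sigma> \<pi>) s (Upper (L0_sgn \<sigma> \<pi>) A) \<and>
      (\<exists>C. C \<subseteq> A \<and> countable C \<and> least (L0_sgn \<sigma> \<pi>) s (Upper (L0_sgn \<sigma> \<pi>) C))"
    if "\<sigma> \<in> {1, - 1}" "A \<subseteq> L0_space \<pi>" "A \<noteq> {}" "bounded_above (L0_sgn \<sigma> \<pi>) A" for \<sigma> A
    using L0_sgn_countable_sup[OF assms that] by blast
  show ?thesis
    unfolding Dedekind_super_complete_def
    using sgn[of 1] sgn[of "- 1"]
    by (simp add: L0_sgn_simps bounded_above_def bounded_below_def L0_space_eq_carrier)
qed

text \<open>Above an enumeration of the countable subset with the same supremum, directedness yields an
  increasing sequence.\<close>

lemma L0_sgn_directed_sup: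
  assumes "sigma_finite_measure \<pi>" and \<sigma>: "\<sigma> \<in> {1, - 1}"
    and M: "M \<subseteq> L0_space \<pi>" "M \<noteq> {}" and bdd: "bounded_above (L0_sgn \<sigma> \<pi>) M"
    and dir: "\<And>x y. x \<in> M \<Longrightarrow> y \<in> M \<Longrightarrow> \<exists>z\<in>M. x \<sqsubseteq>\<^bsub>L0_sgn \<sigma> \<pi>\<^esub> z \<and> y \<sqsubseteq>\<^bsub>L0_sgn \<sigma> \<pi>\<^esub> z"
  shows "\<exists>\<mu>. (\<forall>n. \<mu> n \<in> M) \<and> (\<forall>n. \<mu> n \<sqsubseteq>\<^bsub>L0_sgn \<sigma> \<pi>\<^esub> \<mu> (Suc n)) \<and>
    weakly_ae \<pi> \<mu> (\<Squnion>\<^bsub>L0_sgn \<sigma> \<pi>\<^esub> M)"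
proof -
  let ?L = "L0_sgn \<sigma> \<pi>"
  interpret partial_order ?L by (rule partial_order_L0_sgn[OF \<sigma>])
  obtain s C where lub: "least ?L s (Upper ?L M)" and C: "C \<subseteq> M" "countable C" "C \<noteq> {}"
    and conv: "\<And>\<mu>. (\<forall>n. \<mu> n \<in> M) \<Longrightarrow> (\<forall>n. \<mu> n \<sqsubseteq>\<^bsub>?L\<^esub> \<mu> (Suc n)) \<Longrightarrow>
       (\<forall>c\<in>C. \<exists>n. c \<sqsubseteq>\<^bsub>?L\<^esub> \<mu> n) \<Longrightarrow> weakly_ae \<pi> \<mu> s"
    using L0_sgn_countable_sup[OF assms(1-5)] by blast
  \<comment> \<open>The supremum operator is a Hilbert choice among least upper bounds, so
    antisymmetry is needed to identify it with \<open>s\<close>.\<close>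
  have sup: "\<Squnion>\<^bsub>?L\<^esub> M = s"
  proof -
    have sup: "least ?L (\<Squnion>\<^bsub>?L\<^esub> M) (Upper ?L M)"
      unfolding Lattice.sup_def using lub by (rule someI)
    show ?thesis
      by (rule le_antisym[OF least_le[OF sup least_mem[OF lub]] least_le[OF lub least_mem[OF sup]]
            least_closed[OF sup] least_closed[OF lub]])
  qed
  \<comment> \<open>If \<open>C\<close> is finite the enumeration repeats elements, which is
    harmless: only surjectivity onto \<open>C\<close> is used.\<close>
  let ?c = "from_nat_into C"
  have cM: "?c n \<in> M" for n using from_nat_into[OF C(3)] C(1) by blast
  \<comment> \<open>Each new term is a common upper bound in \<open>M\<close> of the previous term
    and the next enumerated element of \<open>C\<close>.\<close>
  have "\<exists>\<mu>. \<forall>n. (\<mu> n \<in> M \<and> ?c n \<sqsubseteq>\<^bsub>?L\<^esub> \<mu> n) \<and> \<mu> n \<sqsubseteq>\<^bsub>?L\<^esub> \<mu> (Suc n)"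
  proof (rule dependent_nat_choice)
    show "\<exists>x. x \<in> M \<and> ?c 0 \<sqsubseteq>\<^bsub>?L\<^esub> x" using dir[OF cM cM] by blast
    show "\<exists>y. (y \<in> M \<and> ?c (Suc n) \<sqsubseteq>\<^bsub>?L\<^esub> y) \<and> x \<sqsubseteq>\<^bsub>?L\<^esub> y"
      if "x \<in> M \<and> ?c n \<sqsubseteq>\<^bsub>?L\<^esub> x" for x n
      using dir[of x "?c (Suc n)"] that cM by blast
  qed
  then obtain \<mu> where \<mu>: "\<forall>n. \<mu> n \<in> M" "\<forall>n. ?c n \<sqsubseteq>\<^bsub>?L\<^esub> \<mu> n" "\<forall>n. \<mu> n \<sqsubseteq>\<^bsub>?L\<^esub> \<mu> (Suc n)"
    by blast
  have "\<forall>c\<in>C. \<exists>n. c \<sqsubseteq>\<^bsub>?L\<^esub> \<mu> n"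
    using \<mu>(2) from_nat_into_surj[OF C(2)] by metis
  from conv[OF \<mu>(1,3) this] \<mu> sup show ?thesis by blast
qed

theorem theorem3p2:
  fixes \<pi> :: "'a measure"
  assumes "sigma_finite_measure \<pi>"
  shows "Lattice.lattice (L0_st \<pi>) \<and> Dedekind_super_complete (L0_st \<pi>)
    \<and> (\<forall>M. M \<subseteq> carrier (L0_st \<pi>) \<and> M \<noteq> {} \<longrightarrow>
          (bounded_above (L0_st \<pi>) M \<and> directed_upwards (L0_st \<pi>) M \<longrightarrow>
             (\<exists>\<mu> :: nat \<Rightarrow> ('a \<Rightarrow> real measure) set. (\<forall>n. \<mu> n \<in> M) \<and>
                (\<forall>n. \<mu> n \<sqsubseteq>\<^bsub>L0_st \<pi>\<^esub> \<mu> (Suc n)) \<and>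
                weakly_ae \<pi> \<mu> (\<Squnion>\<^bsub>L0_st \<pi>\<^esub> M))) \<and>
          (bounded_below (L0_st \<pi>) M \<and> directed_downwards (L0_st \<pi>) M \<longrightarrow>
             (\<exists>\<mu> :: nat \<Rightarrow> ('a \<Rightarrow> real measure) set. (\<forall>n. \<mu> n \<in> M) \<and>
                (\<forall>n. \<mu> (Suc n) \<sqsubseteq>\<^bsub>L0_st \<pi>\<^esub> \<mu> n) \<and>
                weakly_ae \<pi> \<mu> (\<Sqinter>\<^bsub>L0_st \<pi>\<^esub> M))))"
proof (intro conjI allI impI; (elim conjE)?)
  show lat: "Lattice.lattice (L0_st \<pi>)" by (rule lattice_L0_st[OF assms])
  show "Dedekind_super_complete (L0_st \<pi>)" by (rule Dedekind_super_complete_L0_st[OF assms])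
  interpret Lattice.lattice "L0_st \<pi>" by (rule lat)
  fix M assume M: "M \<subseteq> carrier (L0_st \<pi>)" "M \<noteq> {}"
  {
    assume bdd: "bounded_above (L0_st \<pi>) M" and dir: "directed_upwards (L0_st \<pi>) M"
    \<comment> \<open>An element above the join is above both arguments; the lattice property
      guarantees that the chosen join really is an upper bound.\<close>
    have "\<exists>z\<in>M. x \<sqsubseteq>\<^bsub>L0_st \<pi>\<^esub> z \<and> y \<sqsubseteq>\<^bsub>L0_st \<pi>\<^esub> z" if xy: "x \<in> M" "y \<in> M" for x y
    proof -
      have in_L: "x \<in> carrier (L0_st \<pi>)" "y \<in> carrier (L0_st \<pi>)" using M(1) xy by blast+
      obtain z where z: "z \<in> M" "x \<squnion>\<^bsub>L0_st \<pi>\<^esub> y \<sqsubseteq>\<^bsub>L0_st \<pi>\<^esub> z"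
        using dir xy unfolding directed_upwards_def by blast
      have zL: "z \<in> carrier (L0_st \<pi>)" using M(1) z(1) by blast
      note xyL = join_closed[OF in_L]
      show ?thesis
        using le_trans[OF join_left[OF in_L] z(2) in_L(1) xyL zL]
          le_trans[OF join_right[OF in_L] z(2) in_L(2) xyL zL] z(1) by blast
    qed
    then show "\<exists>\<mu>. (\<forall>n. \<mu> n \<in> M) \<and> (\<forall>n. \<mu> n \<sqsubseteq>\<^bsub>L0_st \<pi>\<^esub> \<mu> (Suc n)) \<and>
        weakly_ae \<pi> \<mu> (\<Squnion>\<^bsub>L0_st \<pi>\<^esub> M)"
      using L0_sgn_directed_sup[OF assms, of 1 M] M bdd by (simp add: L0_sgn_simps L0_space_eq_carrier)
  next
    assume bdd: "bounded_below (L0_st \<pi>) M" and dir: "directed_downwards (L0_st \<pi>) M"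
    have "\<exists>z\<in>M. z \<sqsubseteq>\<^bsub>L0_st \<pi>\<^esub> x \<and> z \<sqsubseteq>\<^bsub>L0_st \<pi>\<^esub> y" if xy: "x \<in> M" "y \<in> M" for x y
    proof -
      have in_L: "x \<in> carrier (L0_st \<pi>)" "y \<in> carrier (L0_st \<pi>)" using M(1) xy by blast+
      obtain z where z: "z \<in> M" "z \<sqsubseteq>\<^bsub>L0_st \<pi>\<^esub> x \<sqinter>\<^bsub>L0_st \<pi>\<^esub> y"
        using dir xy unfolding directed_downwards_def by blast
      have zL: "z \<in> carrier (L0_st \<pi>)" using M(1) z(1) by blast
      note xyL = meet_closed[OF in_L]
      show ?thesis
        using le_trans[OF z(2) meet_left[OF in_L] zL xyL in_L(1)]
          le_trans[OF z(2) meet_right[OF in_L] zL xyL in_L(2)] z(1) by blast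
    qed
    then show "\<exists>\<mu>. (\<forall>n. \<mu> n \<in> M) \<and> (\<forall>n. \<mu> (Suc n) \<sqsubseteq>\<^bsub>L0_st \<pi>\<^esub> \<mu> n) \<and>
        weakly_ae \<pi> \<mu> (\<Sqinter>\<^bsub>L0_st \<pi>\<^esub> M)"
      \<comment> \<open>For sign -1, increasing sequences and suprema of the dual order are
        decreasing sequences and infima of the original one.\<close>
      using L0_sgn_directed_sup[OF assms, of "- 1" M] M bdd
      by (simp add: L0_sgn_simps L0_space_eq_carrier bounded_above_def bounded_below_def)
  }
qed

end
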